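(* Let $(\mathscr{M};\mathcal{H})$, $(\mathscr{N};\mathcal{K})$ be represented von Neumann algebras and $\Phi:\mathscr{M}\to\mathscr{N}$ be a unital normal $*$-homomorphism. Let $\Phi_{\mathrm{aff}}:\mathscr{M}_{\mathrm{aff}}\to\mathscr{N}_{\mathrm{aff}}$ be the extension of $\Phi$ given by $\Phi_{\mathrm{aff}}(A/B)=\Phi(A)/\Phi(B)$. Then for $T_1,T_2\in\mathscr{M}_{\mathrm{aff}}$ we have: (i) $\Phi_{\mathrm{aff}}(T_1+T_2)=\Phi_{\mathrm{aff}}(T_1)+\Phi_{\mathrm{aff}}(T_2)$; (ii) $\Phi_{\mathrm{aff}}(T_1T_2)=\Phi_{\mathrm{aff}}(T_1)\,\Phi_{\mathrm{aff}}(T_2)$; (iii) $\Phi_{\mathrm{aff}}(T_1^{\dagger})=\Phi_{\mathrm{aff}}(T_1)^{\dagger}$, and in particular, if $T\in\mathscr{M}_{\mathrm{aff}}$ is non-singular (that is, one-to-one), then $\Phi_{\mathrm{aff}}(T)$ is non-singular with $\Phi_{\mathrm{aff}}(T^{-1})=\Phi_{\mathrm{aff}}(T)^{-1}$; (iv) $\Phi_{\mathrm{aff}}(T_1^* )=\Phi_{\mathrm{aff}}(T_1)^*$.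
   Context: A represented von Neumann algebra $(\mathscr{M};\mathcal{H})$ is a von Neumann algebra $\mathscr{M}$ acting on a complex Hilbert space $\mathcal{H}$. An unbounded operator on $\mathcal{H}$ is a linear map $T:\mathrm{dom}(T)\to\mathcal{H}$ with $\mathrm{dom}(T)$ a (not necessarily dense) linear subspace of $\mathcal{H}$, and $T$ not necessarily bounded; equality of operators includes equality of domains. For $A,B\in\mathcal{B}(\mathcal{H})$ with $\mathrm{null}(B)\subseteq\mathrm{null}(A)$, the quotient $A/B$ is the unbounded operator with domain $\mathrm{ran}(B)$ given by $Bx\mapsto Ax$ ($x\in\mathcal{H}$). $\mathscr{M}_{\mathrm{aff}} := \{A/B : A,B\in\mathscr{M},\ \mathrm{null}(B)\subseteq\mathrm{null}(A)\}$, which contains $\mathscr{M}$ via $A=A/I$. The map $\Phi_{\mathrm{aff}}$ is defined by $\Phi_{\mathrm{aff}}(A/B):=\Phi(A)/\Phi(B)$ for all $A,B\in\mathscr{M}$ with $\mathrm{null}(B)\subseteq\mathrm{null}(A)$; this makes sense ($\mathrm{null}(\Phi(B))\subseteq\mathrm{null}(\Phi(A))$) and does not depend on the choice of quotient representation. Sums and products: $\mathrm{dom}(S+T)=\mathrm{dom}(S)\cap\mathrm{dom}(T)$; $\mathrm{dom}(ST)=\{x\in\mathrm{dom}(T): Tx\in\mathrm{dom}(S)\}$. The Kaufman inverse $T^{\dagger}$ has $\mathrm{dom}(T^{\dagger})=\mathrm{ran}(T)$ and is given by $Tx\mapsto (I-\mathbf{N}(T))x$, where $\mathbf{N}(T)$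 is the orthogonal projection onto $\overline{\mathrm{null}(T)}$; when $T$ is one-to-one, $T^\dagger=T^{-1}$ with domain $\mathrm{ran}(T)$. The adjoint of a (not necessarily densely-defined) $T$ has domain $\{y\in\mathcal{H}: x\mapsto\langle Tx,y\rangle \text{ continuous on }\mathrm{dom}(T)\}$, and $T^*y$ is the unique $z\in\overline{\mathrm{dom}(T)}$ with $\langle Tx,y\rangle=\langle x,z\rangle$ for all $x\in\mathrm{dom}(T)$. (The set $\mathscr{M}_{\mathrm{aff}}$ is closed under sum, product, Kaufman inverse and adjoint.) *)

theory Defs
  imports "HOL-Analysis.Analysis"
begin

section \<open>Complex Hilbert spaces\<close>

text \<open>
  The inner product \<open>cinner\<close> is linear in its first argument. The real structure is the one
  underlying the complex structure: \<^const>\<open>scaleR\<close> is the restriction of \<open>scaleC\<close>, and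
  \<^const>\<open>inner\<close> is the real part of \<open>cinner\<close>. Since \<open>cinner x x\<close> is real by \<open>cinner_commute\<close>,
  the class \<^class>\<open>real_inner\<close> then yields positive definiteness of \<open>cinner\<close> and
  \<open>norm x = sqrt (Re (cinner x x))\<close>.
\<close>

class complex_hilbert_space = real_inner + banach +
  fixes scaleC :: "complex \<Rightarrow> 'a \<Rightarrow> 'a" (infixr "*\<^sub>C" 75)
    and cinner :: "'a \<Rightarrow> 'a \<Rightarrow> complex"
  assumes scaleC_add_right: "c *\<^sub>C (x + y) = c *\<^sub>C x + c *\<^sub>C y"
    and scaleC_add_left: "(c + d) *\<^sub>C x = c *\<^sub>C x + d *\<^sub>C x"
    and scaleC_scaleC: "c *\<^sub>C d *\<^sub>C x = (c * d) *\<^sub>C x"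
    and scaleR_eq_scaleC: "r *\<^sub>R x = complex_of_real r *\<^sub>C x"
    and cinner_commute: "cinner x y = cnj (cinner y x)"
    and cinner_add_left: "cinner (x + y) z = cinner x z + cinner y z"
    and cinner_scaleC_left: "cinner (c *\<^sub>C x) y = c * cinner x y"
    and inner_eq_Re_cinner: "inner x y = Re (cinner x y)"

text \<open>
  The orthogonal projection onto \<open>V\<close>; meaningful when \<open>V\<close> is a closed complex subspace.
\<close>

definition orth_proj :: "'h::complex_hilbert_space set \<Rightarrow> 'h \<Rightarrow> 'h" where
  "orth_proj V x = (THE p. p \<in> V \<and> (\<forall>v\<in>V. cinner (x - p) v = 0))"

section \<open>Bounded operators and von Neumann algebras\<close>

definition bounded_clinear ::
    "('h::complex_hilbert_space \<Rightarrow> 'k::complex_hilbert_space) \<Rightarrow> bool" where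
  "bounded_clinear A \<longleftrightarrow> bounded_linear A \<and> (\<forall>c x. A (c *\<^sub>C x) = c *\<^sub>C A x)"

definition cadjoint :: "('h::complex_hilbert_space \<Rightarrow> 'h) \<Rightarrow> 'h \<Rightarrow> 'h" where
  "cadjoint A = (THE B. \<forall>x y. cinner (A x) y = cinner x (B y))"

definition null_space :: "('h::complex_hilbert_space \<Rightarrow> 'h) \<Rightarrow> 'h set" where
  "null_space A = {x. A x = 0}"

definition commutant ::
    "('h::complex_hilbert_space \<Rightarrow> 'h) set \<Rightarrow> ('h \<Rightarrow> 'h) set" where
  "commutant S = {B. bounded_clinear B \<and> (\<forall>A\<in>S. A \<circ> B = B \<circ> A)}"

definition unital_star_subalgebra :: "('h::complex_hilbert_space \<Rightarrow> 'h) set \<Rightarrow> bool" where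
  "unital_star_subalgebra M \<longleftrightarrow>
     (\<forall>A\<in>M. bounded_clinear A) \<and> id \<in> M \<and>
     (\<forall>A\<in>M. \<forall>B\<in>M. (\<lambda>x. A x + B x) \<in> M) \<and>
     (\<forall>c. \<forall>A\<in>M. (\<lambda>x. c *\<^sub>C A x) \<in> M) \<and>
     (\<forall>A\<in>M. \<forall>B\<in>M. A \<circ> B \<in> M) \<and>
     (\<forall>A\<in>M. cadjoint A \<in> M)"

text \<open>
  Von Neumann's definition, as in Dixmier's and Takesaki's books: a unital \<open>*\<close>-algebra of bounded
  operators that equals its double commutant.
\<close>

definition von_neumann_algebra :: "('h::complex_hilbert_space \<Rightarrow> 'h) set \<Rightarrow> bool" where
  "von_neumann_algebra M \<longleftrightarrow> unital_star_subalgebra M \<and> commutant (commutant M) = M"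

definition unital_star_homomorphism ::
    "('h::complex_hilbert_space \<Rightarrow> 'h) set \<Rightarrow> ('k::complex_hilbert_space \<Rightarrow> 'k) set
      \<Rightarrow> (('h \<Rightarrow> 'h) \<Rightarrow> ('k \<Rightarrow> 'k)) \<Rightarrow> bool" where
  "unital_star_homomorphism M N \<Phi> \<longleftrightarrow>
     \<Phi> \<in> M \<rightarrow> N \<and> \<Phi> id = id \<and>
     (\<forall>A\<in>M. \<forall>B\<in>M. \<Phi> (\<lambda>x. A x + B x) = (\<lambda>y. \<Phi> A y + \<Phi> B y)) \<and>
     (\<forall>c. \<forall>A\<in>M. \<Phi> (\<lambda>x. c *\<^sub>C A x) = (\<lambda>y. c *\<^sub>C \<Phi> A y)) \<and>
     (\<forall>A\<in>M. \<forall>B\<in>M. \<Phi> (A \<circ> B) = \<Phi> A \<circ> \<Phi> B) \<and>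
     (\<forall>A\<in>M. \<Phi> (cadjoint A) = cadjoint (\<Phi> A))"

definition op_le :: "('h::complex_hilbert_space \<Rightarrow> 'h) \<Rightarrow> ('h \<Rightarrow> 'h) \<Rightarrow> bool" where
  "op_le A B \<longleftrightarrow> (\<forall>x. cinner (B x - A x) x \<in> \<real>\<^sub>\<ge>\<^sub>0)"

definition selfadjoint_part ::
    "('h::complex_hilbert_space \<Rightarrow> 'h) set \<Rightarrow> ('h \<Rightarrow> 'h) set" where
  "selfadjoint_part M = {A \<in> M. cadjoint A = A}"

definition is_op_lub ::
    "('h::complex_hilbert_space \<Rightarrow> 'h) set \<Rightarrow> ('h \<Rightarrow> 'h) set \<Rightarrow> ('h \<Rightarrow> 'h) \<Rightarrow> bool" where
  "is_op_lub M S A \<longleftrightarrow>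
     A \<in> selfadjoint_part M \<and> (\<forall>B\<in>S. op_le B A) \<and>
     (\<forall>C\<in>selfadjoint_part M. (\<forall>B\<in>S. op_le B C) \<longrightarrow> op_le A C)"

text \<open>
  Normality: least upper bounds of increasing nets of self-adjoint elements are preserved. The
  range of such a net is a nonempty upward directed set, and every such set is the range of the
  net it indexes. (The net is bounded because it has an upper bound.)
\<close>

definition normal_map ::
    "('h::complex_hilbert_space \<Rightarrow> 'h) set \<Rightarrow> ('k::complex_hilbert_space \<Rightarrow> 'k) set
      \<Rightarrow> (('h \<Rightarrow> 'h) \<Rightarrow> ('k \<Rightarrow> 'k)) \<Rightarrow> bool" where
  "normal_map M N \<Phi> \<longleftrightarrow>
     (\<forall>S A. S \<subseteq> selfadjoint_part M \<and> S \<noteq> {} \<and>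
        (\<forall>X\<in>S. \<forall>Y\<in>S. \<exists>Z\<in>S. op_le X Z \<and> op_le Y Z) \<and> is_op_lub M S A
        \<longrightarrow> is_op_lub N (\<Phi> ` S) (\<Phi> A))"

section \<open>Unbounded operators\<close>

text \<open>
  An unbounded operator is a partial function with domain \<^const>\<open>dom\<close> and range \<^const>\<open>ran\<close>, so
  that equality includes equality of domains. The product \<open>ST\<close> is \<open>S \<circ>\<^sub>m T\<close>, whose domain is
  \<open>{x \<in> dom T. the (T x) \<in> dom S}\<close>.
\<close>

type_synonym 'h unbounded_op = "'h \<rightharpoonup> 'h"

definition op_add ::
    "'h::complex_hilbert_space unbounded_op \<Rightarrow> 'h unbounded_op \<Rightarrow> 'h unbounded_op" where
  "op_add S T = (\<lambda>x. if x \<in> dom S \<inter> dom T then Some (the (S x) + the (T x)) else None)"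

definition op_null :: "'h::complex_hilbert_space unbounded_op \<Rightarrow> 'h set" where
  "op_null T = {x. T x = Some 0}"

definition kaufman_inverse ::
    "'h::complex_hilbert_space unbounded_op \<Rightarrow> 'h unbounded_op" where
  "kaufman_inverse T = (\<lambda>y. if y \<in> ran T
     then Some (THE z. \<exists>x. T x = Some y \<and> z = x - orth_proj (closure (op_null T)) x)
     else None)"

definition nonsingular :: "'h::complex_hilbert_space unbounded_op \<Rightarrow> bool" where
  "nonsingular T \<longleftrightarrow> inj_on T (dom T)"

text \<open>Meaningful for one-to-one \<open>T\<close> only.\<close>

definition op_inverse ::
    "'h::complex_hilbert_space unbounded_op \<Rightarrow> 'h unbounded_op" where
  "op_inverse T = (\<lambda>y. if y \<in> ran T then Some (THE x. T x = Some y) else None)"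

definition op_adjoint ::
    "'h::complex_hilbert_space unbounded_op \<Rightarrow> 'h unbounded_op" where
  "op_adjoint T = (\<lambda>y. if continuous_on (dom T) (\<lambda>x. cinner (the (T x)) y)
     then Some (THE z. z \<in> closure (dom T) \<and>
                       (\<forall>x\<in>dom T. cinner (the (T x)) y = cinner x z))
     else None)"

section \<open>Quotients and the extension of a homomorphism\<close>

text \<open>\<open>A/B\<close>; meaningful when \<open>null_space B \<subseteq> null_space A\<close>.\<close>

definition quotient_op ::
    "('h::complex_hilbert_space \<Rightarrow> 'h) \<Rightarrow> ('h \<Rightarrow> 'h) \<Rightarrow> 'h unbounded_op" where
  "quotient_op A B =
     (\<lambda>y. if y \<in> range B then Some (THE z. \<exists>x. B x = y \<and> z = A x) else None)"

definition affiliated :: "('h::complex_hilbert_space \<Rightarrow> 'h) set \<Rightarrow> 'h unbounded_op set" where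
  "affiliated M =
     {quotient_op A B | A B. A \<in> M \<and> B \<in> M \<and> null_space B \<subseteq> null_space A}"

text \<open>
  \<open>\<Phi>\<^sub>a\<^sub>f\<^sub>f (A/B) = \<Phi> A / \<Phi> B\<close>. The definite description leaves the value unspecified unless the
  right-hand side is the same for all representations of \<open>T\<close> as a quotient.
\<close>

definition affiliated_ext ::
    "('h::complex_hilbert_space \<Rightarrow> 'h) set \<Rightarrow> (('h \<Rightarrow> 'h) \<Rightarrow> ('k::complex_hilbert_space \<Rightarrow> 'k))
      \<Rightarrow> 'h unbounded_op \<Rightarrow> 'k unbounded_op" where
  "affiliated_ext M \<Phi> T =
     (THE S. \<exists>A\<in>M. \<exists>B\<in>M. null_space B \<subseteq> null_space A \<and>
        T = quotient_op A B \<and> S = quotient_op (\<Phi> A) (\<Phi> B))"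

end

theory Submission
  imports Defs
begin

text \<open>
  Since \<open>\<Phi>\<close> preserves algebraic relations, it suffices to express each operation on quotients by
  such relations together with projections onto null spaces. Normality makes \<open>\<Phi>\<close> preserve these
  projections: the projection onto the closed range of \<open>B\<^sup>*\<close> is the least upper bound of the
  increasing sequence \<open>1 - (1 - B\<^sup>*B/c)\<^sup>2\<^sup>n\<close>.

  The domains of sums, products and adjoints are all obtained from preimages
  \<open>{x. A x \<in> range B}\<close>. If \<open>A = R W\<^sub>1\<close> and \<open>B = R W\<^sub>2\<close> is the polar decomposition of the row
  \<open>(A, B)\<close>, so that \<open>W\<^sub>1W\<^sub>1\<^sup>* + W\<^sub>2W\<^sub>2\<^sup>*\<close> is the range projection of \<open>R\<close>, then this preimage is the
  range of \<open>E = (1 - W\<^sub>1\<^sup>*W\<^sub>1)\<^sup>1\<^sup>/\<^sup>2\<close>. All of these relations survive under \<open>\<Phi>\<close>. Range inclusions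
  between elements of a von Neumann algebra factor inside the algebra (Douglas), which gives
  \<open>U\<close> with \<open>A E = B U\<close> and the independence of \<open>\<Phi>\<^sub>a\<^sub>f\<^sub>f\<close> from the chosen quotient.
\<close>

section \<open>Complex Hilbert spaces\<close>

text \<open>\<Phi> need be neither injective nor surjective, so vectors of the second space cannot
  be traced back to the first, and a pointwise statement such as "A x lies in the range of B" means
  nothing to \<Phi>. Such statements are replaced by equations between elements of \<open>M\<close>
  whose witnesses lie in \<open>M\<close>. Douglas factorization does this for an inclusion of
  ranges. The converse half of a preimage, "if A x lies in the range of B then x lies in the range
  of E", cannot be transported; it is proved a second time over the second space, from the
  transported equations. Hence the preimage criterion speaks of operators subject to a list of
  identities and mentions no algebra, and square roots are recorded only by their square and
  self-adjointness. Null projections are the one ingredient that the algebraic relations do not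
  control, and normality enters there. Most estimates use the real inner product; complex statements
  are recovered from compatibility with multiplication by i.\<close>

lemma cinner_zero_left [simp]: "cinner 0 y = 0"
  using cinner_add_left [of 0 0 y] by simp

lemma cinner_scaleC_right: "cinner x (c *\<^sub>C y) = cnj c * cinner x y"
  by (metis cinner_commute cinner_scaleC_left complex_cnj_mult)

lemma cinner_diff_left: "cinner (x - y) z = cinner x z - cinner y z"
  by (metis add_diff_cancel_right' cinner_add_left diff_add_cancel)

lemma cinner_self: "cinner x x = complex_of_real ((norm x)\<^sup>2)"
proof (rule complex_eqI)
  show "Re (cinner x x) = Re (complex_of_real ((norm x)\<^sup>2))"
    by (simp add: inner_eq_Re_cinner [symmetric] power2_norm_eq_inner)
  have "Im (cinner x x) = - Im (cinner x x)"
    using arg_cong [OF cinner_commute [of x x], of Im] by simp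
  then show "Im (cinner x x) = Im (complex_of_real ((norm x)\<^sup>2))"
    by simp
qed

lemma scaleC_diff_right: "c *\<^sub>C (x - y) = c *\<^sub>C x - c *\<^sub>C (y::'a::complex_hilbert_space)"
  by (metis add_diff_cancel_right' diff_add_cancel scaleC_add_right)

lemma scaleC_zero_right [simp]: "c *\<^sub>C (0::'a::complex_hilbert_space) = 0"
  using scaleC_diff_right [of c 0 0] by simp

lemma norm_scaleC: "norm (c *\<^sub>C x) = cmod c * norm x"
proof -
  have "complex_of_real ((norm (c *\<^sub>C x))\<^sup>2) = c * cnj c * complex_of_real ((norm x)\<^sup>2)"
    by (simp only: cinner_self [symmetric] cinner_scaleC_left cinner_scaleC_right ac_simps)
  also have "\<dots> = complex_of_real ((cmod c * norm x)\<^sup>2)"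
    by (simp add: complex_norm_square [symmetric] power_mult_distrib)
  finally have "(norm (c *\<^sub>C x))\<^sup>2 = (cmod c * norm x)\<^sup>2"
    using of_real_eq_iff by blast
  then show ?thesis
    by simp
qed

lemma Im_cinner: "Im (cinner x y) = inner (- \<i> *\<^sub>C x) y"
  by (simp add: inner_eq_Re_cinner cinner_scaleC_left)

text \<open>Splitting into two real inner products lets orthogonality and adjoint relations be
  checked for \<open>inner\<close> alone.\<close>

lemma cinner_Complex: "cinner x y = Complex (inner x y) (inner (- \<i> *\<^sub>C x) y)"
  by (simp add: complex_eq_iff Im_cinner inner_eq_Re_cinner)

lemma cmod_cinner_le: "cmod (cinner x y) \<le> norm x * norm y"
proof (cases "cinner x y = 0")
  case False
  \<comment> \<open>The unimodular \<open>c\<close> rotates \<open>cinner x y\<close> onto the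
    nonnegative real axis, where the real Cauchy-Schwarz inequality applies.\<close>
  define c where "c = cnj (sgn (cinner x y))"
  have "cmod c = 1"
    using False by (simp add: c_def norm_sgn)
  moreover have "c * cinner x y = complex_of_real (cmod (cinner x y))"
    using complex_norm_square [of "cinner x y"] False
    by (simp add: c_def sgn_eq power2_eq_square field_simps)
  then have "inner (c *\<^sub>C x) y = cmod (cinner x y)"
    by (simp add: inner_eq_Re_cinner cinner_scaleC_left)
  ultimately show ?thesis
    using norm_cauchy_schwarz [of "c *\<^sub>C x" y] by (simp add: norm_scaleC)
qed simp

lemma inner_eqI:
  assumes "\<And>v. inner v x = inner v y"
  shows "x = y"
  by (metis assms inner_eq_zero_iff inner_diff_right right_minus_eq)

lemma continuous_on_cinner_left: "continuous_on S (\<lambda>x. cinner x y)"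
proof -
  have "bounded_linear (\<lambda>x. cinner x y)"
    by (rule bounded_linear_intro [where K = "norm y"])
      (auto simp: cinner_add_left scaleR_eq_scaleC cinner_scaleC_left scaleR_conv_of_real cmod_cinner_le)
  then show ?thesis
    by (simp add: linear_continuous_on)
qed

section \<open>The Riesz representation theorem and orthogonal projections\<close>

text \<open>The representing vector minimises \<open>\<parallel>s\<parallel>\<^sup>2 - 2 f s\<close>; a minimising sequence is Cauchy by
  the parallelogram law.\<close>

lemma riesz_subspace:
  fixes S :: "'a::{real_inner,complete_space} set"
  assumes S: "subspace S"
    and add: "\<And>x y. x \<in> S \<Longrightarrow> y \<in> S \<Longrightarrow> f (x + y) = f x + f y"
    and scale: "\<And>r x. x \<in> S \<Longrightarrow> f (r *\<^sub>R x) = r * f x"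
    and bound: "\<And>x. x \<in> S \<Longrightarrow> \<bar>f x\<bar> \<le> c * norm x"
  obtains z where "z \<in> closure S" "\<And>x. x \<in> S \<Longrightarrow> f x = inner x z"
proof -
  define J where "J x = (norm x)\<^sup>2 - 2 * f x" for x
  define m where "m = Inf (J ` S)"
  \<comment> \<open>Completing the square: \<open>J x\<close> is at least
    \<open>(norm x - c)^2 - c^2\<close>.\<close>
  have J_bound: "- c\<^sup>2 \<le> J x" if "x \<in> S" for x
    using bound [OF that] sum_squares_ge_zero [of "norm x - c" 0]
    by (auto simp: J_def power2_eq_square algebra_simps)
  have S0: "0 \<in> S"
    using S subspace_0 by blast
  have J_ge: "m \<le> J x" if "x \<in> S" for x
    unfolding m_def using that J_bound by (intro cInf_lower bdd_belowI [of _ "- c\<^sup>2"]) auto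
  have "\<exists>x\<in>S. J x < m + inverse (real (Suc n))" for n
    using cInf_lessD [of "J ` S" "m + inverse (real (Suc n))"] S0
    by (auto simp: m_def)
  then obtain u where u: "\<And>n. u n \<in> S" "\<And>n. J (u n) < m + inverse (real (Suc n))"
    by metis
  have J_lim: "(\<lambda>n. J (u n)) \<longlonglongrightarrow> m"
  proof (rule tendsto_sandwich [of "\<lambda>n. m" _ _ "\<lambda>n. m + inverse (real (Suc n))"])
    show "\<forall>\<^sub>F n in sequentially. m \<le> J (u n)"
      using J_ge u(1) by simp
    show "\<forall>\<^sub>F n in sequentially. J (u n) \<le> m + inverse (real (Suc n))"
      using u(2) by (intro always_eventually allI less_imp_le)
    show "(\<lambda>n. m) \<longlonglongrightarrow> m"
      by simp
    show "(\<lambda>n. m + inverse (real (Suc n))) \<longlonglongrightarrow> m"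
      using tendsto_add [OF tendsto_const [of m] LIMSEQ_inverse_real_of_nat] by simp
  qed
  have gap: "(norm (x - y))\<^sup>2 \<le> 2 * (J x - m) + 2 * (J y - m)" if "x \<in> S" "y \<in> S" for x y
  proof -
    have mid: "(1/2) *\<^sub>R (x + y) \<in> S"
      using that S by (simp add: subspace_add subspace_scale)
    have "f ((1/2) *\<^sub>R (x + y)) = (f x + f y) / 2"
      using that S by (simp add: scale add subspace_add)
    moreover have "(norm (x - y))\<^sup>2 = 2 * (norm x)\<^sup>2 + 2 * (norm y)\<^sup>2 - 4 * (norm ((1/2) *\<^sub>R (x + y)))\<^sup>2"
      by (simp add: power2_norm_eq_inner inner_diff inner_add algebra_simps)
    ultimately have "(norm (x - y))\<^sup>2 = 2 * J x + 2 * J y - 4 * J ((1/2) *\<^sub>R (x + y))"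
      by (simp add: J_def)
    then show ?thesis
      using J_ge [OF mid] by simp
  qed
  have "Cauchy u"
  proof (rule metric_CauchyI)
    fix e :: real assume e: "0 < e"
    have "\<forall>\<^sub>F n in sequentially. J (u n) < m + e\<^sup>2 / 4"
      using order_tendstoD(2) [OF J_lim, of "m + e\<^sup>2 / 4"] e by simp
    then obtain N where N: "\<And>n. n \<ge> N \<Longrightarrow> J (u n) < m + e\<^sup>2 / 4"
      by (auto simp: eventually_sequentially)
    have "dist (u p) (u q) < e" if "p \<ge> N" "q \<ge> N" for p q
    proof -
      have "(norm (u p - u q))\<^sup>2 < e\<^sup>2"
        using gap [of "u p" "u q"] u N [OF that(1)] N [OF that(2)] by fastforce
      then show ?thesis
        using e by (simp add: dist_norm power_less_imp_less_base)
    qed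
    then show "\<exists>N. \<forall>p\<ge>N. \<forall>q\<ge>N. dist (u p) (u q) < e"
      by blast
  qed
  then obtain z where z: "u \<longlonglongrightarrow> z"
    using Cauchy_convergent_iff convergent_def by blast
  have "f v = inner v z" if v: "v \<in> S" for v
  proof -
    \<comment> \<open>First variation at the minimiser in the direction \<open>v\<close>, taken as a
      limit along \<open>u\<close> because \<open>z\<close> itself may lie outside
      \<open>S\<close>.\<close>
    have ineq: "0 \<le> 2 * t * (inner v z - f v) + t\<^sup>2 * (norm v)\<^sup>2" for t
    proof -
      have J_expand: "J (u n + t *\<^sub>R v) = J (u n) + 2 * t * (inner v (u n) - f v) + t\<^sup>2 * (norm v)\<^sup>2" for n
      proof -
        have "(norm (u n + t *\<^sub>R v))\<^sup>2 = (norm (u n))\<^sup>2 + 2 * t * inner v (u n) + t * t * (norm v)\<^sup>2"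
          unfolding power2_norm_eq_inner by (simp add: inner_add inner_commute algebra_simps)
        then show ?thesis
          using u(1) v S
          by (simp add: J_def add scale subspace_scale power2_eq_square algebra_simps)
      qed
      have "m \<le> J (u n) + 2 * t * (inner v (u n) - f v) + t\<^sup>2 * (norm v)\<^sup>2" for n
        using J_ge [of "u n + t *\<^sub>R v"] u(1) v S by (simp add: J_expand subspace_add subspace_scale)
      moreover have "(\<lambda>n. J (u n) + 2 * t * (inner v (u n) - f v) + t\<^sup>2 * (norm v)\<^sup>2)
          \<longlonglongrightarrow> m + 2 * t * (inner v z - f v) + t\<^sup>2 * (norm v)\<^sup>2"
        by (intro tendsto_intros J_lim z)
      ultimately have "m \<le> m + 2 * t * (inner v z - f v) + t\<^sup>2 * (norm v)\<^sup>2"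
        by (meson LIMSEQ_le_const)
      then show ?thesis
        by simp
    qed
    show ?thesis
    proof (cases "v = 0")
      case True
      then show ?thesis
        using scale [of 0 0] S0 by simp
    next
      case False
      define d where "d = inner v z - f v"
      \<comment> \<open>This \<open>t\<close> minimises the quadratic, whose value there is
        \<open>- d^2 / (norm v)^2\<close>; nonnegativity forces \<open>d = 0\<close>.\<close>
      have "0 \<le> 2 * (- d / (norm v)\<^sup>2) * d + (- d / (norm v)\<^sup>2)\<^sup>2 * (norm v)\<^sup>2"
        using ineq [of "- d / (norm v)\<^sup>2"] by (simp add: d_def)
      then have "d\<^sup>2 / (norm v)\<^sup>2 \<le> 0"
        using False by (simp add: power2_eq_square field_simps)
      then have "d = 0"
        using False by (simp add: divide_le_0_iff)
      then show ?thesis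
        by (simp add: d_def)
    qed
  qed
  moreover have "z \<in> closure S"
    using z u(1) closure_sequential [of z S] by blast
  ultimately show ?thesis
    using that by blast
qed

section \<open>Closed complex subspaces and orthogonal projections\<close>

definition csubspace :: "'a::complex_hilbert_space set \<Rightarrow> bool" where
  "csubspace V \<longleftrightarrow> subspace V \<and> (\<forall>c. \<forall>x\<in>V. c *\<^sub>C x \<in> V)"

lemma csubspaceD: "csubspace V \<Longrightarrow> x \<in> V \<Longrightarrow> c *\<^sub>C x \<in> V"
  by (simp add: csubspace_def)

lemma csubspace_imp_subspace: "csubspace V \<Longrightarrow> subspace V"
  by (simp add: csubspace_def)

lemma bounded_linear_scaleC: "bounded_linear (\<lambda>x::'a::complex_hilbert_space. c *\<^sub>C x)"
  by (rule bounded_linear_intro [where K = "cmod c"])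
    (auto simp: scaleC_add_right scaleR_eq_scaleC scaleC_scaleC norm_scaleC mult.commute)

lemma csubspace_closure:
  assumes "csubspace V"
  shows "csubspace (closure V)"
proof -
  have "c *\<^sub>C x \<in> closure V" if "x \<in> closure V" for c x
  proof -
    have "(\<lambda>x. c *\<^sub>C x) ` closure V \<subseteq> closure ((\<lambda>x. c *\<^sub>C x) ` V)"
      by (intro closure_bounded_linear_image_subset bounded_linear_scaleC)
    also have "\<dots> \<subseteq> closure V"
      using assms by (intro closure_mono) (auto simp: csubspace_def)
    finally show ?thesis
      using that by blast
  qed
  moreover have "x + y \<in> closure V" if "x \<in> closure V" "y \<in> closure V" for x y
  proof -
    obtain f g where "\<And>n. f n \<in> V" "f \<longlonglongrightarrow> x" "\<And>n. g n \<in> V" "g \<longlonglongrightarrow> y"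
      using \<open>x \<in> closure V\<close> \<open>y \<in> closure V\<close> by (auto simp: closure_sequential)
    then have "(\<lambda>n. f n + g n) \<longlonglongrightarrow> x + y" "\<And>n. f n + g n \<in> V"
      using csubspace_imp_subspace [OF assms] by (auto intro: tendsto_add subspace_add)
    then show ?thesis
      unfolding closure_sequential by (intro exI [of _ "\<lambda>n. f n + g n"]) simp
  qed
  moreover have "0 \<in> closure V"
    using csubspace_imp_subspace [OF assms] closure_subset subspace_0 by blast
  ultimately show ?thesis
    by (simp add: csubspace_def subspace_def scaleR_eq_scaleC)
qed

text \<open>The imaginary part of \<open>cinner v x\<close> is the real inner product of
  \<open>x\<close> with a complex multiple of \<open>v\<close>, which again belongs to
  \<open>V\<close>.\<close>

lemma cinner_orthogonal_iff:
  assumes "csubspace V"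
  shows "(\<forall>v\<in>V. cinner x v = 0) \<longleftrightarrow> (\<forall>v\<in>V. inner v x = 0)"
proof
  assume "\<forall>v\<in>V. cinner x v = 0"
  then have "\<forall>v\<in>V. inner x v = 0"
    by (simp add: inner_eq_Re_cinner)
  then show "\<forall>v\<in>V. inner v x = 0"
    by (simp add: inner_commute)
next
  assume *: "\<forall>v\<in>V. inner v x = 0"
  show "\<forall>v\<in>V. cinner x v = 0"
  proof
    fix v assume "v \<in> V"
    then have "cinner v x = 0"
      using * csubspaceD [OF assms] by (simp add: cinner_Complex complex_eq_iff)
    then show "cinner x v = 0"
      by (metis cinner_commute complex_cnj_zero)
  qed
qed

context
  fixes V :: "'a::complex_hilbert_space set"
  assumes csub: "csubspace V" and clo: "closed V"
begin

lemma orth_proj_unique: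
  assumes "p \<in> V" and "\<And>v. v \<in> V \<Longrightarrow> inner v (x - p) = 0"
  shows "orth_proj V x = p"
  unfolding orth_proj_def
proof (rule the_equality)
  show "p \<in> V \<and> (\<forall>v\<in>V. cinner (x - p) v = 0)"
    using assms by (simp add: cinner_orthogonal_iff [OF csub])
next
  fix q assume q: "q \<in> V \<and> (\<forall>v\<in>V. cinner (x - q) v = 0)"
  then have "\<forall>v\<in>V. inner v (x - q) = 0"
    by (simp add: cinner_orthogonal_iff [OF csub])
  moreover have "p - q \<in> V"
    using assms(1) q csub by (simp add: csubspace_def subspace_diff)
  ultimately have "inner (p - q) (x - q) - inner (p - q) (x - p) = 0"
    using assms(2) by simp
  then have "inner (p - q) (p - q) = 0"
    by (simp add: inner_diff_right)
  then show "q = p"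
    by simp
qed

lemma orth_proj_exists: "\<exists>p. p \<in> V \<and> (\<forall>v\<in>V. inner v (x - p) = 0)"
proof -
  have "\<bar>inner v x\<bar> \<le> norm x * norm v" for v
    using Cauchy_Schwarz_ineq2 [of v x] by (simp add: mult.commute)
  then obtain z where "z \<in> closure V" "\<And>v. v \<in> V \<Longrightarrow> inner v x = inner v z"
    using riesz_subspace [of V "\<lambda>v. inner v x" "norm x"] csub
    by (auto simp: csubspace_def inner_add_left)
  then show ?thesis
    using clo by (auto simp: inner_diff_right)
qed

lemma orth_proj_in: "orth_proj V x \<in> V"
  and orth_proj_orthogonal: "v \<in> V \<Longrightarrow> inner v (x - orth_proj V x) = 0"
  using orth_proj_exists [of x] orth_proj_unique by blast+

lemma orth_proj_ident: "x \<in> V \<Longrightarrow> orth_proj V x = x"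
  by (rule orth_proj_unique) auto

end

section \<open>Bounded operators and their adjoints\<close>

lemma bounded_clinearI:
  assumes "\<And>x y. A (x + y) = A x + A y" and "\<And>c x. A (c *\<^sub>C x) = c *\<^sub>C A x"
    and "\<And>x. norm (A x) \<le> K * norm x"
  shows "bounded_clinear A"
  unfolding bounded_clinear_def using assms
  by (auto intro!: bounded_linear_intro [where K = K] simp: scaleR_eq_scaleC mult.commute)

lemma bounded_clinear_imp_bounded_linear: "bounded_clinear A \<Longrightarrow> bounded_linear A"
  by (simp add: bounded_clinear_def)

lemma bounded_clinear_scaleC: "bounded_clinear A \<Longrightarrow> A (c *\<^sub>C x) = c *\<^sub>C A x"
  by (simp add: bounded_clinear_def)

lemma bounded_clinear_simps:
  assumes "bounded_clinear A"
  shows "A (x + y) = A x + A y" "A (x - y) = A x - A y" "A (- x) = - A x" "A 0 = 0"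
    "A (r *\<^sub>R x) = r *\<^sub>R A x"
  using bounded_clinear_imp_bounded_linear [OF assms] by (simp_all add: linear_simps)

lemma bounded_clinear_bound:
  assumes "bounded_clinear A"
  shows "\<exists>K>0. \<forall>x. norm (A x) \<le> K * norm x"
  using bounded_linear.pos_bounded [OF bounded_clinear_imp_bounded_linear [OF assms]]
  by (auto simp: mult.commute)

lemma bounded_clinear_id: "bounded_clinear id"
  by (rule bounded_clinearI [where K = 1]) auto

lemma bounded_clinear_add:
  "bounded_clinear A \<Longrightarrow> bounded_clinear B \<Longrightarrow> bounded_clinear (\<lambda>x. A x + B x)"
  by (simp add: bounded_clinear_def bounded_linear_add scaleC_add_right)

lemma bounded_clinear_diff:
  "bounded_clinear A \<Longrightarrow> bounded_clinear B \<Longrightarrow> bounded_clinear (\<lambda>x. A x - B x)"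
  by (simp add: bounded_clinear_def bounded_linear_sub scaleC_diff_right)

lemma bounded_clinear_comp:
  "bounded_clinear A \<Longrightarrow> bounded_clinear B \<Longrightarrow> bounded_clinear (A \<circ> B)"
  by (simp add: bounded_clinear_def comp_def bounded_linear_compose)

lemma bounded_clinear_funpow:
  fixes A :: "'h::complex_hilbert_space \<Rightarrow> 'h"
  shows "bounded_clinear A \<Longrightarrow> bounded_clinear (A ^^ n)"
  by (induction n) (simp_all add: bounded_clinear_comp bounded_clinear_id)

lemma bounded_clinear_tendsto:
  "bounded_clinear A \<Longrightarrow> (f \<longlongrightarrow> x) F \<Longrightarrow> ((\<lambda>t. A (f t)) \<longlongrightarrow> A x) F"
  using bounded_linear.tendsto bounded_clinear_imp_bounded_linear by blast

lemma csubspace_null_space: "bounded_clinear A \<Longrightarrow> csubspace (null_space A)"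
  by (simp add: csubspace_def null_space_def subspace_def bounded_clinear_simps
      bounded_clinear_scaleC)

lemma closed_null_space: "bounded_clinear A \<Longrightarrow> closed (null_space A)"
  unfolding null_space_def
  by (intro closed_Collect_eq continuous_on_const linear_continuous_on
      bounded_clinear_imp_bounded_linear)

lemma csubspace_range:
  assumes A: "bounded_clinear A"
  shows "csubspace (range A)"
proof -
  have "c *\<^sub>C A x \<in> range A" for c x
    using bounded_clinear_scaleC [OF A] by (metis rangeI)
  moreover have "A x + A y \<in> range A" for x y
    using bounded_clinear_simps [OF A] by (metis rangeI)
  moreover have "0 \<in> range A"
    using bounded_clinear_simps [OF A] by (metis rangeI)
  ultimately show ?thesis
    by (auto simp: csubspace_def subspace_def scaleR_eq_scaleC)
qed

text \<open>Real adjointness suffices because \<open>A\<close> commutes with multiplication by -i,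
  which exchanges real and imaginary parts of \<open>cinner\<close>.\<close>

lemma cadjoint_unique:
  assumes "\<And>x y. inner (A x) y = inner x (B y)" and A: "bounded_clinear A"
  shows "cadjoint A = B"
  unfolding cadjoint_def
proof (rule the_equality)
  show "\<forall>x y. cinner (A x) y = cinner x (B y)"
    by (simp add: cinner_Complex assms(1) [symmetric] bounded_clinear_scaleC [OF A]
        bounded_clinear_simps [OF A])
next
  fix C assume C: "\<forall>x y. cinner (A x) y = cinner x (C y)"
  have "C y = B y" for y
  proof (rule inner_eqI)
    show "inner v (C y) = inner v (B y)" for v
      using arg_cong [OF C [rule_format, of v y], of Re] assms(1) [of v y]
      by (simp add: inner_eq_Re_cinner)
  qed
  then show "C = B"
    by blast
qed

lemma cadjoint_exists:
  fixes A :: "'h::complex_hilbert_space \<Rightarrow> 'h"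
  assumes A: "bounded_clinear A"
  shows "\<exists>B. bounded_clinear B \<and> (\<forall>x y. inner (A x) y = inner x (B y))"
proof -
  obtain K where K: "0 < K" "\<And>x. norm (A x) \<le> K * norm x"
    using bounded_clinear_bound [OF A] by blast
  have "\<exists>z. \<forall>x. inner (A x) y = inner x z" for y
  proof -
    have bound: "\<bar>inner (A x) y\<bar> \<le> (K * norm y) * norm x" for x
      using Cauchy_Schwarz_ineq2 [of "A x" y] mult_right_mono [OF K(2) [of x] norm_ge_zero [of y]]
      by (simp add: ac_simps)
    show ?thesis
      by (rule riesz_subspace [of UNIV "\<lambda>x. inner (A x) y" "K * norm y"])
        (use bound in \<open>auto simp: bounded_clinear_simps [OF A] inner_add_left\<close>)
  qed
  then obtain B where B: "\<And>x y. inner (A x) y = inner x (B y)"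
    by metis
  have "bounded_clinear B"
  proof (rule bounded_clinearI)
    show "B (x + y) = B x + B y" for x y
      by (rule inner_eqI) (simp add: B [symmetric] inner_add_right)
    show "B (c *\<^sub>C x) = c *\<^sub>C B x" for c x
    proof (rule inner_eqI)
      fix v
      have scaleC_left: "inner u (c *\<^sub>C w) = inner (cnj c *\<^sub>C u) w" for u w :: 'h
        by (simp add: inner_eq_Re_cinner cinner_scaleC_left cinner_scaleC_right)
      show "inner v (B (c *\<^sub>C x)) = inner v (c *\<^sub>C B x)"
        by (simp only: B [symmetric] scaleC_left bounded_clinear_scaleC [OF A])
    qed
    show "norm (B x) \<le> K * norm x" for x
    proof (cases "B x = 0")
      case False
      have "(norm (B x))\<^sup>2 = inner (A (B x)) x"
        by (simp add: power2_norm_eq_inner B)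
      also have "\<dots> \<le> norm (A (B x)) * norm x"
        by (rule norm_cauchy_schwarz)
      also have "\<dots> \<le> K * norm (B x) * norm x"
        by (intro mult_right_mono K) simp
      finally show ?thesis
        using False by (simp add: power2_eq_square)
    qed (use K in simp)
  qed
  then show ?thesis
    using B by blast
qed

lemma
  assumes A: "bounded_clinear A"
  shows bounded_clinear_cadjoint: "bounded_clinear (cadjoint A)"
    and inner_cadjoint_right: "inner x (cadjoint A y) = inner (A x) y"
    and inner_cadjoint_left: "inner (cadjoint A x) y = inner x (A y)"
proof -
  obtain B where B: "bounded_clinear B" "\<And>x y. inner (A x) y = inner x (B y)"
    using cadjoint_exists [OF A] by blast
  have "cadjoint A = B"
    by (rule cadjoint_unique [OF B(2) A])
  then show "bounded_clinear (cadjoint A)" "inner x (cadjoint A y) = inner (A x) y"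
    using B by simp_all
  then show "inner (cadjoint A x) y = inner x (A y)"
    using B \<open>cadjoint A = B\<close> by (simp add: inner_commute)
qed

lemma cadjoint_cadjoint: "bounded_clinear A \<Longrightarrow> cadjoint (cadjoint A) = A"
  by (rule cadjoint_unique) (auto simp: inner_cadjoint_left bounded_clinear_cadjoint)

lemma cadjoint_comp:
  "bounded_clinear A \<Longrightarrow> bounded_clinear B \<Longrightarrow> cadjoint (A \<circ> B) = cadjoint B \<circ> cadjoint A"
  by (rule cadjoint_unique) (auto simp: inner_cadjoint_right bounded_clinear_comp)

lemma cinner_cadjoint_right:
  "bounded_clinear A \<Longrightarrow> cinner x (cadjoint A y) = cinner (A x) y"
  by (simp add: cinner_Complex inner_cadjoint_right bounded_clinear_scaleC bounded_clinear_simps)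

text \<open>The bound makes sending \<open>B u\<close> to \<open>inner u w\<close> a well-defined
  bounded functional on \<open>range B\<close>, and \<open>z\<close> is its Riesz vector. This turns
  membership in an operator range into an inequality; polar factors, preimages and domains of
  adjoints all rest on it.\<close>

lemma in_range_cadjoint:
  assumes B: "bounded_clinear B" and bound: "\<And>u. \<bar>inner u w\<bar> \<le> c * norm (B u)"
  shows "\<exists>z\<in>closure (range B). cadjoint B z = w"
proof -
  have eq: "inner u w = inner v w" if "B u = B v" for u v
    using bound [of "u - v"] that by (simp add: bounded_clinear_simps [OF B] inner_diff_left)
  \<comment> \<open>Any preimage may be chosen, since by \<open>eq\<close> the value depends on
    \<open>B u\<close> alone.\<close>
  define f where "f s = inner (SOME u. B u = s) w" for s
  have f: "f (B u) = inner u w" for u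
    unfolding f_def by (rule eq) (rule someI_ex, blast)
  have "\<exists>z\<in>closure (range B). \<forall>s\<in>range B. f s = inner s z"
  proof (rule riesz_subspace [of "range B" f c])
    show "subspace (range B)"
      by (intro csubspace_imp_subspace csubspace_range B)
    show "f (x + y) = f x + f y" if "x \<in> range B" "y \<in> range B" for x y
      using that by (auto simp: f inner_add_left simp flip: bounded_clinear_simps(1) [OF B])
    show "f (r *\<^sub>R x) = r * f x" if "x \<in> range B" for r x
      using that by (auto simp: f simp flip: bounded_clinear_simps(5) [OF B])
    show "\<bar>f x\<bar> \<le> c * norm x" if "x \<in> range B" for x
      using that bound by (auto simp: f)
  qed blast
  then obtain z where z: "z \<in> closure (range B)" "\<And>u. inner u w = inner (B u) z"
    by (auto simp: f)
  have "cadjoint B z = w"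
    by (rule inner_eqI) (simp add: inner_cadjoint_right [OF B] z)
  then show ?thesis
    using z(1) by blast
qed

lemma in_range_cadjointI:
  assumes "bounded_clinear B" and "\<And>u. \<bar>inner u w\<bar> \<le> c * norm (B u)"
  shows "w \<in> range (cadjoint B)"
  using in_range_cadjoint [OF assms] by auto

subsection \<open>Projections onto null spaces and closures of ranges\<close>

lemma bounded_clinear_orth_proj:
  assumes V: "csubspace V" "closed V"
  shows "bounded_clinear (orth_proj V)"
proof (rule bounded_clinearI)
  note sub = csubspace_imp_subspace [OF V(1)]
  show "orth_proj V (x + y) = orth_proj V x + orth_proj V y" for x y
  proof (rule orth_proj_unique [OF V])
    fix v assume "v \<in> V"
    then show "inner v (x + y - (orth_proj V x + orth_proj V y)) = 0"
      using orth_proj_orthogonal [OF V, of v x] orth_proj_orthogonal [OF V, of v y]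
      by (simp add: inner_diff_right inner_add_right)
  qed (intro subspace_add sub orth_proj_in V)
  show "orth_proj V (c *\<^sub>C x) = c *\<^sub>C orth_proj V x" for c x
  proof (rule orth_proj_unique [OF V])
    fix v assume "v \<in> V"
    then have "inner (cnj c *\<^sub>C v) (x - orth_proj V x) = 0"
      by (intro orth_proj_orthogonal V csubspaceD)
    then show "inner v (c *\<^sub>C x - c *\<^sub>C orth_proj V x) = 0"
      by (simp add: inner_eq_Re_cinner cinner_scaleC_left cinner_scaleC_right
          flip: scaleC_diff_right)
  qed (intro csubspaceD orth_proj_in V)
  show "norm (orth_proj V x) \<le> 1 * norm x" for x
  proof -
    have "(norm (orth_proj V x))\<^sup>2 = inner (orth_proj V x) x"
      using orth_proj_orthogonal [OF V orth_proj_in [OF V], of x x]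
      by (simp add: inner_diff_right power2_norm_eq_inner)
    also have "\<dots> \<le> norm (orth_proj V x) * norm x"
      by (rule norm_cauchy_schwarz)
    finally show ?thesis
      by (cases "orth_proj V x = 0") (simp_all add: power2_eq_square)
  qed
qed

lemma inner_orth_proj_left:
  assumes V: "csubspace V" "closed V"
  shows "inner (orth_proj V x) y = inner x (orth_proj V y)"
  using orth_proj_orthogonal [OF V orth_proj_in [OF V], of x y]
    orth_proj_orthogonal [OF V orth_proj_in [OF V], of y x]
  by (simp add: inner_diff_right inner_commute)

definition null_proj :: "('h::complex_hilbert_space \<Rightarrow> 'h) \<Rightarrow> 'h \<Rightarrow> 'h" where
  "null_proj A = orth_proj (null_space A)"

definition range_proj :: "('h::complex_hilbert_space \<Rightarrow> 'h) \<Rightarrow> 'h \<Rightarrow> 'h" where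
  "range_proj A = orth_proj (closure (range A))"

context
  fixes A :: "'h::complex_hilbert_space \<Rightarrow> 'h"
  assumes A: "bounded_clinear A"
begin

lemma bounded_clinear_null_proj: "bounded_clinear (null_proj A)"
  unfolding null_proj_def
  by (intro bounded_clinear_orth_proj csubspace_null_space closed_null_space A)

lemma bounded_clinear_range_proj: "bounded_clinear (range_proj A)"
  unfolding range_proj_def
  by (intro bounded_clinear_orth_proj csubspace_closure csubspace_range A closed_closure)

lemma apply_null_proj: "A (null_proj A x) = 0"
  using orth_proj_in [OF csubspace_null_space [OF A] closed_null_space [OF A]]
  by (simp add: null_proj_def null_space_def)

lemma null_proj_ident: "A x = 0 \<Longrightarrow> null_proj A x = x"
  unfolding null_proj_def
  by (rule orth_proj_ident [OF csubspace_null_space [OF A] closed_null_space [OF A]])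
    (simp add: null_space_def)

lemma inner_null_proj_left: "inner (null_proj A x) y = inner x (null_proj A y)"
  unfolding null_proj_def
  by (rule inner_orth_proj_left [OF csubspace_null_space [OF A] closed_null_space [OF A]])

lemma null_proj_idem: "null_proj A (null_proj A x) = null_proj A x"
  by (simp add: apply_null_proj null_proj_ident)

lemma range_proj_in: "range_proj A x \<in> closure (range A)"
  unfolding range_proj_def
  by (rule orth_proj_in [OF csubspace_closure [OF csubspace_range [OF A]] closed_closure])

lemma range_proj_ident: "x \<in> closure (range A) \<Longrightarrow> range_proj A x = x"
  unfolding range_proj_def
  by (rule orth_proj_ident [OF csubspace_closure [OF csubspace_range [OF A]] closed_closure])

end

text \<open>The closed range of \<open>A\<close> is the orthogonal complement of the null space of
  \<open>cadjoint A\<close>. Membership of range projections in the algebra and their preservation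
  by \<Phi> thereby reduce to null projections.\<close>

lemma range_proj_eq:
  assumes A: "bounded_clinear A"
  shows "range_proj A x = x - null_proj (cadjoint A) x"
proof -
  note A' = bounded_clinear_cadjoint [OF A]
  note N = bounded_clinear_null_proj [OF A']
  have "null_proj (cadjoint A) (A u) = 0" for u
    by (rule inner_eqI)
      (simp add: inner_null_proj_left [OF A', symmetric] inner_cadjoint_left [OF A, symmetric]
        apply_null_proj [OF A'])
  then have "closure (range A) \<subseteq> null_space (null_proj (cadjoint A))"
    by (intro closure_minimal closed_null_space N) (auto simp: null_space_def)
  then have 1: "null_proj (cadjoint A) (range_proj A x) = 0"
    using range_proj_in [OF A] by (auto simp: null_space_def)
  have perp: "inner (A u) (x - range_proj A x) = 0" for u
    unfolding range_proj_def
    by (rule orth_proj_orthogonal [OF csubspace_closure [OF csubspace_range [OF A]] closed_closure])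
      (rule subsetD [OF closure_subset], rule rangeI)
  have "cadjoint A (x - range_proj A x) = 0"
    by (rule inner_eqI) (simp add: inner_cadjoint_right [OF A] perp)
  then have "null_proj (cadjoint A) (x - range_proj A x) = x - range_proj A x"
    by (rule null_proj_ident [OF A'])
  then show ?thesis
    using 1 by (simp add: bounded_clinear_simps [OF N] algebra_simps)
qed

lemma range_proj_apply: "bounded_clinear A \<Longrightarrow> range_proj A (A x) = A x"
  by (rule range_proj_ident) (assumption, rule subsetD [OF closure_subset], rule rangeI)

lemma cadjoint_range_proj_apply:
  "bounded_clinear A \<Longrightarrow> cadjoint A (range_proj A x) = cadjoint A x"
  by (simp add: range_proj_eq bounded_clinear_cadjoint apply_null_proj
      bounded_clinear_simps [OF bounded_clinear_cadjoint])

lemma closure_range_cadjoint_iff: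
  assumes A: "bounded_clinear A"
  shows "x \<in> closure (range (cadjoint A)) \<longleftrightarrow> null_proj A x = 0"
proof -
  note A' = bounded_clinear_cadjoint [OF A]
  have "range_proj (cadjoint A) x = x - null_proj A x"
    by (simp add: range_proj_eq A' cadjoint_cadjoint [OF A])
  then show ?thesis
    using range_proj_in [OF A', of x] range_proj_ident [OF A', of x] by auto
qed

section \<open>Uniform boundedness\<close>

text \<open>Baire category: the closed sets \<open>F n\<close> exhaust the space, so one of them
  contains a ball.\<close>

lemma uniform_boundedness_inner:
  fixes V :: "'a::{real_inner,complete_space} set"
  assumes pw: "\<And>x. \<exists>c. \<forall>v\<in>V. \<bar>inner x v\<bar> \<le> c"
  obtains c where "0 < c" "\<And>v. v \<in> V \<Longrightarrow> norm v \<le> c"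
proof -
  define F where "F n = {x. \<forall>v\<in>V. \<bar>inner x v\<bar> \<le> real n}" for n
  have closed_F: "closed (F n)" for n
  proof -
    have "F n = (\<Inter>v\<in>V. {x. \<bar>inner x v\<bar> \<le> real n})"
      by (auto simp: F_def)
    then show ?thesis
      by (auto intro!: closed_INT closed_Collect_le continuous_intros)
  qed
  have "(\<Union>n. F n) = UNIV"
  proof -
    have "x \<in> (\<Union>n. F n)" for x
    proof -
      obtain c where c: "\<And>v. v \<in> V \<Longrightarrow> \<bar>inner x v\<bar> \<le> c"
        using pw by blast
      obtain n where "c \<le> real n"
        using real_arch_simple by blast
      then have "x \<in> F n"
        using c by (force simp: F_def)
      then show ?thesis
        by blast
    qed
    then show ?thesis
      by blast
  qed
  then have "\<not> (\<forall>T\<in>range F. closed T \<and> interior T = {})"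
    using Met_TC.metric_Baire_category_alt [of "range F"] by (force simp: complete_UNIV)
  then have "\<exists>n. interior (F n) \<noteq> {}"
    using closed_F by blast
  then obtain n x r where r: "0 < r" "ball x r \<subseteq> F n"
    by (metis ex_in_conv mem_interior)
  have "norm v \<le> 4 * real n / r" if v: "v \<in> V" for v
  proof (cases "v = 0")
    case False
    \<comment> \<open>A multiple of \<open>v\<close> of length \<open>r / 2\<close> keeps
      \<open>x + y\<close> in the ball, so \<open>inner y v\<close>, a difference of two values
      bounded by \<open>n\<close>, is at most \<open>2 * n\<close>.\<close>
    define y where "y = (r / (2 * norm v)) *\<^sub>R v"
    have "x \<in> F n" "x + y \<in> F n"
      using r False by (auto simp: y_def dist_norm)
    then have "\<bar>inner x v\<bar> \<le> real n" "\<bar>inner (x + y) v\<bar> \<le> real n"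
      using v by (auto simp: F_def)
    then have "inner y v \<le> 2 * real n"
      by (simp add: inner_add_left)
    moreover have "inner y v = r * norm v / 2"
      using False by (simp add: y_def power2_norm_eq_inner [symmetric] power2_eq_square)
    ultimately show ?thesis
      using r(1) by (simp add: field_simps)
  qed (use r in simp)
  then show ?thesis
    using that [of "4 * real n / r + 1"] r(1) by (fastforce simp: add_nonneg_pos)
qed

section \<open>Square roots\<close>

text \<open>With \<open>Y\<^sub>n\<^sub>+\<^sub>1 = (D + Y\<^sub>n\<^sup>2) / 2\<close> the limit \<open>Y\<close> satisfies \<open>(1 - Y)\<^sup>2 = 1 - D\<close>. The scalar
  iteration for \<open>D = 1\<close> increases to \<open>1\<close>, and its increments dominate those of \<open>Y\<^sub>n\<close>.\<close>

primrec sqrt_iter :: "('h::complex_hilbert_space \<Rightarrow> 'h) \<Rightarrow> nat \<Rightarrow> 'h \<Rightarrow> 'h" where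
  "sqrt_iter D 0 = (\<lambda>x. 0)"
| "sqrt_iter D (Suc n) = (\<lambda>x. (1/2) *\<^sub>R (D x + sqrt_iter D n (sqrt_iter D n x)))"

primrec sqrt_iter_bound :: "nat \<Rightarrow> real" where
  "sqrt_iter_bound 0 = 0"
| "sqrt_iter_bound (Suc n) = (1 + (sqrt_iter_bound n)\<^sup>2) / 2"

lemma sqrt_iter_bound_le_1: "0 \<le> sqrt_iter_bound n" "sqrt_iter_bound n \<le> 1"
  by (induction n) (auto simp: power_le_one)

lemma sqrt_iter_bound_mono: "sqrt_iter_bound n \<le> sqrt_iter_bound (n + k)"
proof -
  have step: "sqrt_iter_bound n \<le> sqrt_iter_bound (Suc n)" for n
    using zero_le_power2 [of "1 - sqrt_iter_bound n"]
    by (simp add: power2_eq_square algebra_simps)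
  show ?thesis
    by (rule lift_Suc_mono_le [of sqrt_iter_bound, OF step]) simp
qed

lemma bounded_clinear_scaleR: "bounded_clinear A \<Longrightarrow> bounded_clinear (\<lambda>x. r *\<^sub>R A x)"
  by (auto simp: bounded_clinear_def bounded_linear_const_scaleR)
    (simp add: scaleR_eq_scaleC scaleC_scaleC mult.commute)

lemma bounded_clinear_sqrt_iter: "bounded_clinear D \<Longrightarrow> bounded_clinear (sqrt_iter D n)"
proof (induction n)
  case (Suc n)
  have "bounded_clinear (\<lambda>x. D x + (sqrt_iter D n \<circ> sqrt_iter D n) x)"
    by (intro bounded_clinear_add bounded_clinear_comp Suc)
  then show ?case
    using bounded_clinear_scaleR by simp
qed (auto intro: bounded_clinearI [where K = 0])

lemma norm_sqrt_iter_le: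
  assumes contr: "\<And>x. norm (D x) \<le> norm x"
  shows "norm (sqrt_iter D n x) \<le> sqrt_iter_bound n * norm x"
proof (induction n arbitrary: x)
  case (Suc n)
  have "norm (sqrt_iter D n (sqrt_iter D n x)) \<le> sqrt_iter_bound n * (sqrt_iter_bound n * norm x)"
    by (rule order_trans [OF Suc mult_left_mono [OF Suc sqrt_iter_bound_le_1(1)]])
  then have "norm (D x + sqrt_iter D n (sqrt_iter D n x))
      \<le> norm x + sqrt_iter_bound n * (sqrt_iter_bound n * norm x)"
    using contr [of x] norm_triangle_le [of "D x"] by (meson add_mono)
  moreover have "norm (sqrt_iter D (Suc n) x) = norm (D x + sqrt_iter D n (sqrt_iter D n x)) / 2"
    by (simp only: sqrt_iter.simps norm_scaleR, simp?)
  ultimately show ?case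
    by (simp add: power2_eq_square algebra_simps)
qed simp

text \<open>The difference of the squares of two iterates \<open>Z\<close> and \<open>Y\<close>
  splits as \<open>Z (Z - Y) + (Z - Y) Y\<close>. With scalar bounds \<open>t\<close> and
  \<open>s\<close> the two estimates add up to \<open>t^2 - s^2\<close>, which is twice the next
  scalar increment.\<close>

lemma norm_sqrt_iter_diff_le:
  assumes D: "bounded_clinear D" and contr: "\<And>x. norm (D x) \<le> norm x"
  shows "norm (sqrt_iter D (n + k) x - sqrt_iter D n x)
    \<le> (sqrt_iter_bound (n + k) - sqrt_iter_bound n) * norm x"
proof (induction n arbitrary: x)
  case 0
  then show ?case
    using norm_sqrt_iter_le [of D k x, OF contr] by simp
next
  case (Suc n)
  let ?Y = "sqrt_iter D n" and ?Z = "sqrt_iter D (n + k)"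
  let ?s = "sqrt_iter_bound n" and ?t = "sqrt_iter_bound (n + k)"
  have "norm (?Z (?Z x - ?Y x)) \<le> ?t * ((?t - ?s) * norm x)"
    by (rule order_trans [OF norm_sqrt_iter_le [OF contr] mult_left_mono [OF Suc sqrt_iter_bound_le_1(1)]])
  moreover have "norm (?Z (?Y x) - ?Y (?Y x)) \<le> (?t - ?s) * (?s * norm x)"
    using sqrt_iter_bound_mono [of n k]
    by (intro order_trans [OF Suc mult_left_mono [OF norm_sqrt_iter_le [OF contr]]]) simp
  moreover have "?Z (?Z x) - ?Y (?Y x) = ?Z (?Z x - ?Y x) + (?Z (?Y x) - ?Y (?Y x))"
    by (simp add: bounded_clinear_simps [OF bounded_clinear_sqrt_iter [OF D]])
  ultimately have "norm (?Z (?Z x) - ?Y (?Y x)) \<le> ?t * ((?t - ?s) * norm x) + (?t - ?s) * (?s * norm x)"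
    by (metis norm_triangle_mono)
  moreover have "sqrt_iter D (Suc n + k) x - sqrt_iter D (Suc n) x = (1/2) *\<^sub>R (?Z (?Z x) - ?Y (?Y x))"
    by (simp add: algebra_simps)
  then have "norm (sqrt_iter D (Suc n + k) x - sqrt_iter D (Suc n) x) = norm (?Z (?Z x) - ?Y (?Y x)) / 2"
    by (simp only: norm_scaleR, simp?)
  moreover have "(sqrt_iter_bound (Suc n + k) - sqrt_iter_bound (Suc n)) * norm x
      = (?t * ((?t - ?s) * norm x) + (?t - ?s) * (?s * norm x)) / 2"
    by (simp add: power2_eq_square field_simps)
  ultimately show ?case
    by (simp only: divide_right_mono zero_le_numeral)
qed

text \<open>\<open>E\<close> is \<open>1 - Y\<close> for the limit \<open>Y\<close> of the
  iteration. Every iterate is a polynomial in \<open>D\<close>, so whatever commutes with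
  \<open>D\<close> commutes with \<open>E\<close>; this last clause later places \<open>E\<close> in
  the algebra.\<close>

lemma sqrt_exists:
  fixes D :: "'h::complex_hilbert_space \<Rightarrow> 'h"
  assumes D: "bounded_clinear D" and sa: "\<And>x y. inner (D x) y = inner x (D y)"
    and contr: "\<And>x. norm (D x) \<le> norm x"
  obtains E where "bounded_clinear E" "cadjoint E = E" "\<And>x. E (E x) = x - D x"
    "\<And>U x. bounded_clinear U \<Longrightarrow> (\<And>y. U (D y) = D (U y)) \<Longrightarrow> U (E x) = E (U x)"
proof -
  let ?Y = "sqrt_iter D" and ?s = sqrt_iter_bound
  note Y = bounded_clinear_sqrt_iter [OF D]
  have "incseq ?s"
    using sqrt_iter_bound_mono by (metis incseq_def le_Suc_ex)
  then have s_lim: "?s \<longlonglongrightarrow> (SUP n. ?s n)"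
    using sqrt_iter_bound_le_1 by (intro LIMSEQ_incseq_SUP bdd_aboveI [of _ 1]) auto
  have "Cauchy (\<lambda>n. ?Y n x)" for x
  proof (rule CauchyI')
    fix e :: real assume e: "0 < e"
    have "Cauchy ?s"
      using s_lim by (rule LIMSEQ_imp_Cauchy)
    \<comment> \<open>Dividing by \<open>norm x + 1\<close> avoids a separate case for
      \<open>x = 0\<close>.\<close>
    then obtain M where M: "\<And>m n. m \<ge> M \<Longrightarrow> n \<ge> M \<Longrightarrow> dist (?s m) (?s n) < e / (norm x + 1)"
      using e by (metis metric_CauchyD divide_pos_pos add_nonneg_pos norm_ge_zero zero_less_one)
    have "dist (?Y m x) (?Y n x) < e" if mn: "m \<ge> M" "m < n" for m n
    proof -
      obtain k where k: "n = m + k"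
        using less_imp_add_positive [OF mn(2)] by blast
      have "dist (?Y m x) (?Y n x) \<le> (?s n - ?s m) * norm x"
        using norm_sqrt_iter_diff_le [OF D contr, of m k x] k by (simp add: dist_norm norm_minus_commute)
      also have "\<dots> \<le> (?s n - ?s m) * (norm x + 1)"
        using sqrt_iter_bound_mono [of m k] k by (intro mult_left_mono) auto
      also have "\<dots> < e"
        using M [of m n] mn sqrt_iter_bound_mono [of m k] k
        by (simp add: dist_real_def pos_less_divide_eq add_nonneg_pos)
      finally show ?thesis .
    qed
    then show "\<exists>M. \<forall>m\<ge>M. \<forall>n>m. dist (?Y m x) (?Y n x) < e"
      by blast
  qed
  then have "\<exists>y. (\<lambda>n. ?Y n x) \<longlonglongrightarrow> y" for x
    by (simp add: Cauchy_convergent_iff convergent_def)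
  then obtain Z where Z: "\<And>x. (\<lambda>n. ?Y n x) \<longlonglongrightarrow> Z x"
    by metis
  have norm_Y: "norm (?Y n x) \<le> norm x" for n x
    using norm_sqrt_iter_le [OF contr, of n x] sqrt_iter_bound_le_1 [of n]
    by (meson order_trans mult_left_le_one_le norm_ge_zero)
  have bZ: "bounded_clinear Z"
  proof (rule bounded_clinearI)
    show "Z (x + y) = Z x + Z y" for x y
      using tendsto_add [OF Z [of x] Z [of y]] Z [of "x + y"]
      by (simp add: bounded_clinear_simps [OF Y] LIMSEQ_unique)
    show "Z (c *\<^sub>C x) = c *\<^sub>C Z x" for c x
      using bounded_linear.tendsto [OF bounded_linear_scaleC Z [of x], of c] Z [of "c *\<^sub>C x"]
      by (simp add: bounded_clinear_scaleC [OF Y] LIMSEQ_unique)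
    show "norm (Z x) \<le> 1 * norm x" for x
      using tendsto_norm [OF Z [of x]] norm_Y [of _ x] by (auto intro: LIMSEQ_le_const2)
  qed
  \<comment> \<open>Operator and argument vary together; contractivity of \<open>?Y n\<close>
    absorbs the error in the argument.\<close>
  have ZZ: "(\<lambda>n. ?Y n (?Y n x)) \<longlonglongrightarrow> Z (Z x)" for x
  proof -
    have "(\<lambda>n. ?Y n (?Y n x - Z x)) \<longlonglongrightarrow> 0"
    proof (rule Lim_null_comparison)
      show "\<forall>\<^sub>F n in sequentially. norm (?Y n (?Y n x - Z x)) \<le> norm (?Y n x - Z x)"
        by (simp add: norm_Y)
      show "(\<lambda>n. norm (?Y n x - Z x)) \<longlonglongrightarrow> 0"
        using Z [of x] by (simp add: LIM_zero tendsto_norm_zero)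
    qed
    from tendsto_add [OF this Z [of "Z x"]] show ?thesis
      by (simp add: bounded_clinear_simps [OF Y])
  qed
  have Z_eq: "Z x = (1/2) *\<^sub>R (D x + Z (Z x))" for x
  proof (rule LIMSEQ_unique [OF LIMSEQ_Suc [OF Z]])
    show "(\<lambda>n. ?Y (Suc n) x) \<longlonglongrightarrow> (1/2) *\<^sub>R (D x + Z (Z x))"
      unfolding sqrt_iter.simps by (intro tendsto_intros ZZ)
  qed
  define E where "E = (\<lambda>x. id x - Z x)"
  have bE: "bounded_clinear E"
    unfolding E_def by (intro bounded_clinear_diff bounded_clinear_id bZ)
  have sa_Y: "inner (?Y n x) y = inner x (?Y n y)" for n x y
    by (induction n arbitrary: x y) (simp_all add: sa inner_add_left inner_add_right)
  have "inner (Z x) y = inner x (Z y)" for x y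
    using tendsto_inner [OF Z [of x] tendsto_const [of y]] tendsto_inner [OF tendsto_const [of x] Z [of y]]
    by (simp add: sa_Y LIMSEQ_unique)
  then have "cadjoint E = E"
    by (intro cadjoint_unique bE) (simp add: E_def inner_diff_left inner_diff_right)
  moreover have "E (E x) = x - D x" for x
  proof -
    have "Z x + Z x = D x + Z (Z x)"
      using arg_cong [OF Z_eq [of x], of "\<lambda>u. 2 *\<^sub>R u"] by (simp add: scaleR_2)
    then show ?thesis
      by (simp add: E_def bounded_clinear_simps [OF bZ] algebra_simps)
  qed
  moreover have "U (E x) = E (U x)" if U: "bounded_clinear U" and comm: "\<And>y. U (D y) = D (U y)" for U x
  proof -
    have "U (?Y n y) = ?Y n (U y)" for n y
      by (induction n arbitrary: y) (simp_all add: bounded_clinear_simps [OF U] comm)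
    then have "U (Z x) = Z (U x)"
      using bounded_clinear_tendsto [OF U Z [of x]] Z [of "U x"] by (simp add: LIMSEQ_unique)
    then show ?thesis
      by (simp add: E_def bounded_clinear_simps [OF U])
  qed
  ultimately show ?thesis
    using bE that by blast
qed

section \<open>Von Neumann algebras\<close>

lemma scaleC_minus_one [simp]: "(-1) *\<^sub>C x = - (x::'a::complex_hilbert_space)"
  using scaleR_eq_scaleC [of "-1" x] by simp

text \<open>Evaluating the form at \<open>x + D x\<close> leaves only
  \<open>2 * inner (D x) (D x)\<close>.\<close>

lemma inner_symmetric_eq_zero:
  fixes D :: "'a::real_inner \<Rightarrow> 'a"
  assumes add: "\<And>x y. D (x + y) = D x + D y" and sa: "\<And>x y. inner (D x) y = inner x (D y)"
    and zero: "\<And>x. inner (D x) x = 0"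
  shows "D x = 0"
proof -
  have "inner (D (x + D x)) (x + D x) = 2 * inner (D x) (D x)"
    using zero [of x] zero [of "D x"] sa [of "D x" x]
    by (simp add: add inner_add_left inner_add_right)
  then show ?thesis
    using zero [of "x + D x"] by simp
qed

locale vN_algebra =
  fixes M :: "('h::complex_hilbert_space \<Rightarrow> 'h) set"
  assumes von_neumann: "von_neumann_algebra M"
begin

lemma
  shows bounded: "A \<in> M \<Longrightarrow> bounded_clinear A"
    and id_mem: "id \<in> M"
    and add_mem: "A \<in> M \<Longrightarrow> B \<in> M \<Longrightarrow> (\<lambda>x. A x + B x) \<in> M"
    and scaleC_mem: "A \<in> M \<Longrightarrow> (\<lambda>x. c *\<^sub>C A x) \<in> M"
    and comp_mem: "A \<in> M \<Longrightarrow> B \<in> M \<Longrightarrow> A \<circ> B \<in> M"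
    and cadjoint_mem: "A \<in> M \<Longrightarrow> cadjoint A \<in> M"
  using von_neumann by (simp_all add: von_neumann_algebra_def unital_star_subalgebra_def)

lemma diff_mem: "A \<in> M \<Longrightarrow> B \<in> M \<Longrightarrow> (\<lambda>x. A x - B x) \<in> M"
  using add_mem [of A "\<lambda>x. (-1) *\<^sub>C B x"] scaleC_mem [of B "-1"] by simp

lemma scaleR_mem: "A \<in> M \<Longrightarrow> (\<lambda>x. r *\<^sub>R A x) \<in> M"
  using scaleC_mem by (simp add: scaleR_eq_scaleC)

lemma funpow_mem: "A \<in> M \<Longrightarrow> A ^^ n \<in> M"
  by (induction n) (simp_all add: id_mem comp_mem)

lemma commutant_bounded: "U \<in> commutant M \<Longrightarrow> bounded_clinear U"
  by (simp add: commutant_def)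

lemma commutant_commutes: "U \<in> commutant M \<Longrightarrow> A \<in> M \<Longrightarrow> A (U x) = U (A x)"
  by (auto simp: commutant_def fun_eq_iff)

lemma cadjoint_commutant:
  assumes U: "U \<in> commutant M"
  shows "cadjoint U \<in> commutant M"
proof -
  have "A \<circ> cadjoint U = cadjoint U \<circ> A" if A: "A \<in> M" for A
  proof -
    have "U \<circ> cadjoint A = cadjoint A \<circ> U"
      using commutant_commutes [OF U cadjoint_mem [OF A]] by auto
    then have "cadjoint (U \<circ> cadjoint A) = cadjoint (cadjoint A \<circ> U)"
      by simp
    then show ?thesis
      using commutant_bounded [OF U] bounded [OF A]
      by (simp add: cadjoint_comp cadjoint_cadjoint bounded_clinear_cadjoint)
  qed
  then show ?thesis
    using commutant_bounded [OF U] by (simp add: commutant_def bounded_clinear_cadjoint)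
qed

text \<open>The equality with the double commutant is exploited here: operators obtained as limits
  or by choice enter \<open>M\<close> because they commute with the commutant.\<close>

lemma memI:
  assumes "bounded_clinear Z" and "\<And>U x. U \<in> commutant M \<Longrightarrow> U (Z x) = Z (U x)"
  shows "Z \<in> M"
proof -
  have "Z \<in> commutant (commutant M)"
    unfolding commutant_def [of "commutant M"] using assms by auto
  then show ?thesis
    using von_neumann by (simp add: von_neumann_algebra_def)
qed

text \<open>The commutant is closed under adjoints, so each of its elements leaves both the null
  space of \<open>A\<close> and its orthogonal complement invariant and hence commutes with the
  projection.\<close>

lemma null_proj_mem:
  assumes A: "A \<in> M"
  shows "null_proj A \<in> M"
proof (rule memI)
  note bA = bounded [OF A]
  show "bounded_clinear (null_proj A)"
    by (rule bounded_clinear_null_proj [OF bA])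
  fix U x assume U: "U \<in> commutant M"
  note bU = commutant_bounded [OF U]
  have "null_proj A (U x) = U (null_proj A x)"
    unfolding null_proj_def
  proof (rule orth_proj_unique [OF csubspace_null_space [OF bA] closed_null_space [OF bA]])
    show "U (orth_proj (null_space A) x) \<in> null_space A"
      using commutant_commutes [OF U A] apply_null_proj [OF bA]
      by (simp add: null_space_def null_proj_def bounded_clinear_simps [OF bU])
    fix v assume "v \<in> null_space A"
    then have "cadjoint U v \<in> null_space A"
      using commutant_commutes [OF cadjoint_commutant [OF U] A]
      by (simp add: null_space_def bounded_clinear_simps [OF bounded_clinear_cadjoint [OF bU]])
    then have "inner (cadjoint U v) (x - orth_proj (null_space A) x) = 0"
      by (rule orth_proj_orthogonal [OF csubspace_null_space [OF bA] closed_null_space [OF bA]])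
    then show "inner v (U x - U (orth_proj (null_space A) x)) = 0"
      by (simp add: inner_cadjoint_left [OF bU] bounded_clinear_simps [OF bU])
  qed
  then show "U (null_proj A x) = null_proj A (U x)"
    by simp
qed

lemma range_proj_alt: "A \<in> M \<Longrightarrow> range_proj A = (\<lambda>x. id x - null_proj (cadjoint A) x)"
  using range_proj_eq bounded by auto

lemma range_proj_mem: "A \<in> M \<Longrightarrow> range_proj A \<in> M"
  by (simp only: range_proj_alt diff_mem id_mem null_proj_mem cadjoint_mem)

lemma sqrt_mem:
  assumes D: "D \<in> M" "cadjoint D = D" and contr: "\<And>x. norm (D x) \<le> norm x"
  shows "\<exists>E\<in>M. cadjoint E = E \<and> (\<forall>x. E (E x) = x - D x)"
proof -
  have "inner (D x) y = inner x (D y)" for x y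
    using inner_cadjoint_left [OF bounded [OF D(1)], of x y] by (simp add: D(2))
  then obtain E where E: "bounded_clinear E" "cadjoint E = E" "\<And>x. E (E x) = x - D x"
    "\<And>U x. bounded_clinear U \<Longrightarrow> (\<And>y. U (D y) = D (U y)) \<Longrightarrow> U (E x) = E (U x)"
    using sqrt_exists [OF bounded [OF D(1)] _ contr] by metis
  have "E \<in> M"
    using E(1,4) commutant_bounded commutant_commutes [OF _ D(1)] by (intro memI) auto
  then show ?thesis
    using E by blast
qed

text \<open>The factor \<open>C\<close> is bounded by the uniform boundedness principle for the functionals
  \<open>\<langle>x, A\<^sup>* v\<rangle> = \<langle>C x, B\<^sup>* v\<rangle>\<close> with \<open>\<parallel>B\<^sup>* v\<parallel> \<le> 1\<close>.\<close>

lemma range_subset_factor: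
  assumes A: "A \<in> M" and B: "B \<in> M" and sub: "range A \<subseteq> range B"
  obtains C where "C \<in> M" "\<And>x. B (C x) = A x" "\<And>x. null_proj B (C x) = 0"
proof -
  note bA = bounded [OF A] and bB = bounded [OF B]
  note N = bounded_clinear_null_proj [OF bB]
  have "\<exists>y. B y = A x \<and> null_proj B y = 0" for x
  proof -
    obtain u where "A x = B u"
      using sub by blast
    then show ?thesis
      by (intro exI [of _ "u - null_proj B u"])
        (simp add: bounded_clinear_simps [OF bB] bounded_clinear_simps [OF N]
          apply_null_proj [OF bB] null_proj_idem [OF bB])
  qed
  \<comment> \<open>The preimage orthogonal to the null space of \<open>B\<close> is unique
    (\<open>uniq\<close> below). Uniqueness makes the choice linear and makes it commute with the
    commutant.\<close>
  then obtain C where C: "\<And>x. B (C x) = A x" and NC: "\<And>x. null_proj B (C x) = 0"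
    by metis
  have uniq: "u = v" if "B u = B v" "null_proj B u = 0" "null_proj B v = 0" for u v
    using null_proj_ident [OF bB, of "u - v"] that
    by (simp add: bounded_clinear_simps [OF bB] bounded_clinear_simps [OF N])
  define V where "V = {cadjoint A v | v. norm (cadjoint B v) \<le> 1}"
  have swap: "inner x (cadjoint A v) = inner (C x) (cadjoint B v)" for x v
    by (simp add: inner_cadjoint_right bA bB C)
  have "\<exists>c. \<forall>w\<in>V. \<bar>inner x w\<bar> \<le> c" for x
  proof -
    have "\<bar>inner x w\<bar> \<le> norm (C x)" if w: "w \<in> V" for w
    proof -
      obtain v where v: "w = cadjoint A v" "norm (cadjoint B v) \<le> 1"
        using w by (auto simp: V_def)
      have "\<bar>inner x w\<bar> \<le> norm (C x) * norm (cadjoint B v)"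
        by (simp add: v(1) swap Cauchy_Schwarz_ineq2)
      also have "\<dots> \<le> norm (C x)"
        using v(2) by (simp add: mult_left_le)
      finally show ?thesis .
    qed
    then show ?thesis
      by blast
  qed
  then obtain c where c: "0 < c" "\<And>w. w \<in> V \<Longrightarrow> norm w \<le> c"
    using uniform_boundedness_inner [of V] by metis
  have bound: "inner (C x) (cadjoint B v) \<le> c * norm x * norm (cadjoint B v)" for x v
  proof (cases "cadjoint B v = 0")
    case False
    define t where "t = norm (cadjoint B v)"
    have t: "t > 0"
      using False by (simp add: t_def)
    define v' where "v' = (1 / t) *\<^sub>R v"
    have B_v: "cadjoint B v = t *\<^sub>R cadjoint B v'"
      using t by (simp add: v'_def bounded_clinear_simps [OF bounded_clinear_cadjoint [OF bB]])
    have "norm (cadjoint B v') = 1"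
      using t by (simp add: v'_def bounded_clinear_simps [OF bounded_clinear_cadjoint [OF bB]] t_def)
    then have "norm (cadjoint A v') \<le> c"
      by (intro c) (auto simp: V_def)
    then have "inner x (cadjoint A v') \<le> norm x * c"
      by (meson mult_left_mono norm_cauchy_schwarz norm_ge_zero order_trans)
    then show ?thesis
      using t by (subst B_v) (simp add: swap t_def [symmetric] mult.commute mult.left_commute)
  qed simp
  have norm_C: "norm (C x) \<le> c * norm x" for x
  proof -
    \<comment> \<open>The bound passes to the closure of \<open>range (cadjoint B)\<close>, which
      contains \<open>C x\<close>; the test vector \<open>w = C x\<close> then bounds its
      norm.\<close>
    have "closed {w. inner (C x) w \<le> c * norm x * norm w}"
      by (intro closed_Collect_le continuous_intros)
    then have "closure (range (cadjoint B)) \<subseteq> {w. inner (C x) w \<le> c * norm x * norm w}"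
      by (rule closure_minimal [rotated]) (use bound in auto)
    moreover have "C x \<in> closure (range (cadjoint B))"
      by (simp add: closure_range_cadjoint_iff bB NC)
    ultimately have "norm (C x) * norm (C x) \<le> c * norm x * norm (C x)"
      by (auto simp: power2_norm_eq_inner [symmetric] power2_eq_square)
    then show ?thesis
      using c(1) by (cases "C x = 0") simp_all
  qed
  have bC: "bounded_clinear C"
  proof (rule bounded_clinearI [OF _ _ norm_C])
    show "C (x + y) = C x + C y" for x y
      by (rule uniq) (simp_all add: C NC bounded_clinear_simps [OF bA]
          bounded_clinear_simps [OF bB] bounded_clinear_simps [OF N])
    show "C (a *\<^sub>C x) = a *\<^sub>C C x" for a x
      by (rule uniq) (simp_all add: C NC bounded_clinear_scaleC bA bB N)
  qed
  have "C \<in> M"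
  proof (rule memI [OF bC])
    fix U x assume U: "U \<in> commutant M"
    show "U (C x) = C (U x)"
    proof (rule uniq)
      show "B (U (C x)) = B (C (U x))"
        by (simp add: C commutant_commutes [OF U A] commutant_commutes [OF U B])
      show "null_proj B (U (C x)) = 0"
        using commutant_commutes [OF U null_proj_mem [OF B]] NC
        by (simp add: bounded_clinear_simps [OF commutant_bounded [OF U]])
    qed (rule NC)
  qed
  then show ?thesis
    using C NC that by blast
qed

end

section \<open>Support projections as least upper bounds\<close>

text \<open>The quadratic form of a self-adjoint operator is real, so only real parts have to be
  compared.\<close>

lemma op_le_iff:
  assumes "A \<in> selfadjoint_part M" "B \<in> selfadjoint_part M" "vN_algebra M"
  shows "op_le A B \<longleftrightarrow> (\<forall>x. inner (A x) x \<le> inner (B x) x)"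
proof -
  have sa: "bounded_clinear A" "bounded_clinear B" "cadjoint A = A" "cadjoint B = B"
    using assms vN_algebra.bounded by (auto simp: selfadjoint_part_def)
  have "Im (cinner (C x) x) = 0" if "bounded_clinear C" "cadjoint C = C" for C :: "'a \<Rightarrow> 'a" and x
    using cinner_cadjoint_right [OF that(1), of x x] cinner_commute [of "C x" x] that(2)
    by (simp add: complex_eq_iff)
  then show ?thesis
    using sa
    by (simp add: op_le_def complex_nonneg_Reals_iff cinner_diff_left inner_eq_Re_cinner)
qed

text \<open>A self-adjoint operator is determined by its quadratic form, which makes the order
  antisymmetric.\<close>

lemma is_op_lub_unique:
  assumes M: "vN_algebra M" and "is_op_lub M S A" "is_op_lub M S B"
  shows "A = B"
proof -
  have AB: "A \<in> selfadjoint_part M" "B \<in> selfadjoint_part M" "op_le A B" "op_le B A"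
    using assms by (auto simp: is_op_lub_def)
  have sa: "bounded_clinear A" "bounded_clinear B" "cadjoint A = A" "cadjoint B = B"
    using AB M vN_algebra.bounded by (auto simp: selfadjoint_part_def)
  have "inner (A x) x = inner (B x) x" for x
    using AB op_le_iff [OF _ _ M] by (meson order_antisym)
  moreover have "inner (A x) y = inner x (A y)" "inner (B x) y = inner x (B y)" for x y
    using sa by (metis inner_cadjoint_left)+
  ultimately have "A x - B x = 0" for x
    by (intro inner_symmetric_eq_zero [of "\<lambda>x. A x - B x"])
      (simp_all add: sa bounded_clinear_simps inner_diff_left inner_diff_right)
  then show ?thesis
    by auto
qed

text \<open>For \<open>c \<ge> \<parallel>B\<parallel>\<^sup>2\<close> the powers of the contraction \<open>D = 1 - B\<^sup>*B/c\<close> converge strongly to the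
  projection onto the null space of \<open>B\<close>.\<close>

definition null_iter :: "real \<Rightarrow> ('h::complex_hilbert_space \<Rightarrow> 'h) \<Rightarrow> 'h \<Rightarrow> 'h" where
  "null_iter c B = (\<lambda>x. id x - (1/c) *\<^sub>R (cadjoint B \<circ> B) x)"

text \<open>With the even power the quadratic form becomes
  \<open>(norm x)^2 - (norm (D^n x))^2\<close>, so monotonicity in \<open>n\<close> follows from
  contractivity of \<open>D\<close>.\<close>

definition support_approx :: "real \<Rightarrow> ('h::complex_hilbert_space \<Rightarrow> 'h) \<Rightarrow> nat \<Rightarrow> 'h \<Rightarrow> 'h" where
  "support_approx c B n = (\<lambda>x. id x - ((null_iter c B ^^ n) \<circ> (null_iter c B ^^ n)) x)"

context
  fixes B :: "'h::complex_hilbert_space \<Rightarrow> 'h" and c :: real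
  assumes B: "bounded_clinear B" and c: "0 < c" "\<And>x. (norm (cadjoint B x))\<^sup>2 \<le> c * (norm x)\<^sup>2"
begin

abbreviation (input) "D \<equiv> null_iter c B"
abbreviation (input) "K \<equiv> \<lambda>x. (1/c) *\<^sub>R cadjoint B (B x)"

lemma bounded_clinear_null_iter: "bounded_clinear D"
  unfolding null_iter_def
  by (intro bounded_clinear_diff bounded_clinear_id bounded_clinear_scaleR bounded_clinear_comp
      bounded_clinear_cadjoint B)

lemma inner_null_iter_left: "inner (D x) y = inner x (D y)"
  by (simp add: null_iter_def inner_diff_left inner_diff_right inner_cadjoint_left
      inner_cadjoint_right B)

lemma inner_null_iter_pow_left: "inner ((D ^^ n) x) y = inner x ((D ^^ n) y)"
  by (induction n arbitrary: x y) (simp_all add: inner_null_iter_left funpow_swap1)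

text \<open>The choice of \<open>c\<close> gives \<open>(norm (K x))^2 \<le> inner (K x) x\<close>.
  Keeping the loss term, instead of mere contractivity, is what drives the convergence
  below.\<close>

lemma norm_null_iter_le: "(norm (D x))\<^sup>2 \<le> (norm x)\<^sup>2 - (norm (K x))\<^sup>2"
proof -
  have "(norm (K x))\<^sup>2 = (1 / c\<^sup>2) * (norm (cadjoint B (B x)))\<^sup>2"
    by (simp add: power_divide)
  also have "\<dots> \<le> (1 / c\<^sup>2) * (c * (norm (B x))\<^sup>2)"
    by (intro mult_left_mono c) simp
  also have "\<dots> = inner (K x) x"
    using c(1) by (simp add: inner_cadjoint_left B power2_eq_square flip: power2_norm_eq_inner)
  finally have "(norm (K x))\<^sup>2 \<le> inner (K x) x" .
  moreover have "(norm (D x))\<^sup>2 = (norm x)\<^sup>2 - 2 * inner (K x) x + (norm (K x))\<^sup>2"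
    unfolding power2_norm_eq_inner
    by (simp add: null_iter_def inner_diff_left inner_diff_right inner_commute)
  ultimately show ?thesis
    by simp
qed

lemma norm_null_iter_contraction: "norm (D x) \<le> norm x"
proof (rule power2_le_imp_le)
  show "(norm (D x))\<^sup>2 \<le> (norm x)\<^sup>2"
    using norm_null_iter_le [of x] zero_le_power2 [of "norm (K x)"] by linarith
qed simp

lemma norm_null_iter_pow_contraction: "norm ((D ^^ n) x) \<le> norm x"
  by (induction n) (auto intro: order_trans norm_null_iter_contraction)

lemma norm_null_iter_pow_antimono: "m \<le> n \<Longrightarrow> norm ((D ^^ n) x) \<le> norm ((D ^^ m) x)"
  by (rule lift_Suc_antimono_le [of "\<lambda>n. norm ((D ^^ n) x)"])
    (simp_all add: norm_null_iter_contraction)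

text \<open>The squared norms of the powers decrease to a limit, so their successive differences,
  which dominate the loss terms, tend to 0. \<open>K\<close> commutes with \<open>D\<close>, so the
  loss term is the sequence in question.\<close>

lemma null_iter_pow_K_tendsto: "(\<lambda>n. (D ^^ n) (K x)) \<longlonglongrightarrow> 0"
proof -
  have K_D: "K (D y) = D (K y)" for y
    by (simp add: null_iter_def bounded_clinear_simps B bounded_clinear_cadjoint algebra_simps)
  have swap: "(D ^^ n) (K x) = K ((D ^^ n) x)" for n
    by (induction n) (simp_all only: funpow.simps id_apply comp_apply K_D)
  have "decseq (\<lambda>n. (norm ((D ^^ n) x))\<^sup>2)"
    by (auto simp: decseq_def intro!: power_mono norm_null_iter_pow_antimono)
  then obtain l where l: "(\<lambda>n. (norm ((D ^^ n) x))\<^sup>2) \<longlonglongrightarrow> l"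
    using decseq_convergent [of _ 0] by (metis zero_le_power2)
  have "(\<lambda>n. (norm (K ((D ^^ n) x)))\<^sup>2) \<longlonglongrightarrow> 0"
  proof (rule tendsto_sandwich)
    show "\<forall>\<^sub>F n in sequentially. 0 \<le> (norm (K ((D ^^ n) x)))\<^sup>2"
      by simp
    show "\<forall>\<^sub>F n in sequentially. (norm (K ((D ^^ n) x)))\<^sup>2
        \<le> (norm ((D ^^ n) x))\<^sup>2 - (norm ((D ^^ Suc n) x))\<^sup>2"
      using norm_null_iter_le by (intro always_eventually allI) (simp add: algebra_simps)
    show "(\<lambda>n. (norm ((D ^^ n) x))\<^sup>2 - (norm ((D ^^ Suc n) x))\<^sup>2) \<longlonglongrightarrow> 0"
      using tendsto_diff [OF l LIMSEQ_Suc [OF l]] by simp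
  qed simp
  then have "(\<lambda>n. norm (K ((D ^^ n) x))) \<longlonglongrightarrow> 0"
    using tendsto_real_sqrt by fastforce
  then show ?thesis
    by (simp only: swap tendsto_norm_zero_iff)
qed

text \<open>The powers fix the null space of \<open>B\<close> pointwise. Since
  \<open>cadjoint B \<circ> B\<close> has the same null space, the orthogonal complement is the
  closure of its range; the powers tend to 0 on that range by the preceding limit, and on its
  closure by contractivity.\<close>

lemma null_iter_pow_tendsto: "(\<lambda>n. (D ^^ n) x) \<longlonglongrightarrow> null_proj B x"
proof -
  let ?H = "cadjoint B \<circ> B"
  have bH: "bounded_clinear ?H"
    by (intro bounded_clinear_comp bounded_clinear_cadjoint B)
  have sa_H: "cadjoint ?H = ?H"
    by (simp add: cadjoint_comp cadjoint_cadjoint bounded_clinear_cadjoint B)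
  note Dn = bounded_clinear_funpow [OF bounded_clinear_null_iter]
  have null_H: "B y = 0" if "?H y = 0" for y
    using that inner_cadjoint_left [OF B, of "B y" y] by simp
  have lim_perp: "(\<lambda>n. (D ^^ n) y) \<longlonglongrightarrow> 0" if y: "null_proj B y = 0" for y
  proof -
    have "null_proj ?H y = 0"
    proof -
      have "B (null_proj ?H y) = 0"
        by (rule null_H [OF apply_null_proj [OF bH]])
      then have "null_proj B (null_proj ?H y) = null_proj ?H y"
        by (rule null_proj_ident [OF B])
      then have "inner (null_proj ?H y) (null_proj ?H y) = inner y (null_proj ?H (null_proj B (null_proj ?H y)))"
        by (simp add: inner_null_proj_left [OF bH] null_proj_idem [OF bH])
      also have "\<dots> = inner y (null_proj B (null_proj ?H y))"
        by (simp add: null_proj_ident [OF bH] apply_null_proj [OF B]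
            bounded_clinear_simps [OF bounded_clinear_cadjoint [OF B]])
      also have "\<dots> = 0"
        by (simp add: inner_null_proj_left [OF B, symmetric] y)
      finally show ?thesis
        by simp
    qed
    then have y_cl: "y \<in> closure (range ?H)"
      using closure_range_cadjoint_iff [OF bH] sa_H by simp
    show ?thesis
    proof (rule LIMSEQ_I)
      fix e :: real assume e: "0 < e"
      obtain u where u: "dist (?H u) y < e / 2"
        using y_cl e closure_approachable [of y "range ?H"] by (auto dest!: spec [of _ "e / 2"])
      have H_K: "?H u = K (c *\<^sub>R u)"
        using c(1) by (simp add: bounded_clinear_simps [OF B]
            bounded_clinear_simps [OF bounded_clinear_cadjoint [OF B]])
      obtain n0 where n0: "\<And>n. n \<ge> n0 \<Longrightarrow> norm ((D ^^ n) (?H u)) < e / 2"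
        using LIMSEQ_D [OF null_iter_pow_K_tendsto [of "c *\<^sub>R u"], of "e / 2"] e
        unfolding H_K by auto
      have "norm ((D ^^ n) y - 0) < e" if "n \<ge> n0" for n
      proof -
        have "norm ((D ^^ n) (y - ?H u)) < e / 2"
          using norm_null_iter_pow_contraction [of n "y - ?H u"] u
          by (simp add: dist_norm norm_minus_commute)
        then have "norm ((D ^^ n) (y - ?H u) + (D ^^ n) (?H u)) < e"
          using n0 [OF that] norm_triangle_ineq [of "(D ^^ n) (y - ?H u)" "(D ^^ n) (?H u)"] by linarith
        then show ?thesis
          by (simp add: bounded_clinear_simps [OF Dn])
      qed
      then show "\<exists>n0. \<forall>n\<ge>n0. norm ((D ^^ n) y - 0) < e"
        by blast
    qed
  qed
  have "(D ^^ n) (null_proj B x) = null_proj B x" for n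
    by (induction n)
      (simp_all add: null_iter_def apply_null_proj [OF B]
        bounded_clinear_simps [OF bounded_clinear_cadjoint [OF B]])
  then have "(D ^^ n) x = (D ^^ n) (x - null_proj B x) + null_proj B x" for n
    by (simp add: bounded_clinear_simps [OF Dn])
  moreover have "(\<lambda>n. (D ^^ n) (x - null_proj B x) + null_proj B x) \<longlonglongrightarrow> 0 + null_proj B x"
    by (intro tendsto_add lim_perp tendsto_const)
      (simp add: bounded_clinear_simps [OF bounded_clinear_null_proj [OF B]] null_proj_idem [OF B])
  ultimately show ?thesis
    by simp
qed

lemma inner_support_approx: "inner (support_approx c B n x) x = (norm x)\<^sup>2 - (norm ((D ^^ n) x))\<^sup>2"
  by (simp add: support_approx_def inner_diff_left power2_norm_eq_inner inner_null_iter_pow_left)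

lemma support_approx_selfadjoint:
  assumes M: "vN_algebra M" and BM: "B \<in> M"
  shows "support_approx c B n \<in> selfadjoint_part M"
proof -
  interpret vN_algebra M
    by (rule M)
  have "support_approx c B n \<in> M"
    unfolding support_approx_def null_iter_def
    by (intro diff_mem id_mem comp_mem funpow_mem scaleR_mem cadjoint_mem BM)
  moreover from this have "cadjoint (support_approx c B n) = support_approx c B n"
    by (intro cadjoint_unique bounded)
      (simp_all add: support_approx_def inner_diff_left inner_diff_right inner_null_iter_pow_left)
  ultimately show ?thesis
    by (simp add: selfadjoint_part_def)
qed

lemma support_approx_directed:
  assumes M: "vN_algebra M" and BM: "B \<in> M" and "m \<le> n"
  shows "op_le (support_approx c B m) (support_approx c B n)"
  using op_le_iff [OF support_approx_selfadjoint [OF M BM] support_approx_selfadjoint [OF M BM] M]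
    norm_null_iter_pow_antimono [OF assms(3)]
  by (simp add: inner_support_approx)

text \<open>Strong convergence gives convergence of the quadratic forms, and limits of real
  inequalities yield both the bound and its minimality.\<close>

lemma is_op_lub_support_approx:
  assumes M: "vN_algebra M" and BM: "B \<in> M"
  shows "is_op_lub M (range (support_approx c B)) (\<lambda>x. id x - null_proj B x)"
    (is "is_op_lub M _ ?P")
proof -
  interpret vN_algebra M
    by (rule M)
  have "?P \<in> M"
    by (intro diff_mem id_mem null_proj_mem BM)
  moreover from this have "cadjoint ?P = ?P"
    by (intro cadjoint_unique bounded)
      (simp_all add: inner_diff_left inner_diff_right inner_null_proj_left B)
  ultimately have P: "?P \<in> selfadjoint_part M"
    by (simp add: selfadjoint_part_def)
  have inner_P: "inner (?P x) x = (norm x)\<^sup>2 - (norm (null_proj B x))\<^sup>2" for x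
    by (simp add: inner_diff_left power2_norm_eq_inner inner_null_proj_left B null_proj_idem)
  have lim: "(\<lambda>n. inner (support_approx c B n x) x) \<longlonglongrightarrow> inner (?P x) x" for x
    unfolding inner_P inner_support_approx
    by (intro tendsto_diff tendsto_const tendsto_power tendsto_norm null_iter_pow_tendsto)
  have "inner (support_approx c B m x) x \<le> inner (?P x) x" for m x
  proof (rule LIMSEQ_le_const [OF lim])
    show "\<exists>N. \<forall>n\<ge>N. inner (support_approx c B m x) x \<le> inner (support_approx c B n x) x"
      using support_approx_directed [OF M BM, of m]
        op_le_iff [OF support_approx_selfadjoint [OF M BM] support_approx_selfadjoint [OF M BM] M]
      by blast
  qed
  then have "op_le (support_approx c B m) ?P" for m
    using op_le_iff [OF support_approx_selfadjoint [OF M BM] P M] by blast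
  moreover have "op_le ?P C"
    if C: "C \<in> selfadjoint_part M" and ub: "\<And>m. op_le (support_approx c B m) C" for C
  proof -
    have "inner (?P x) x \<le> inner (C x) x" for x
      using ub op_le_iff [OF support_approx_selfadjoint [OF M BM] C M]
      by (intro LIMSEQ_le_const2 [OF lim]) blast
    then show ?thesis
      using op_le_iff [OF P C M] by blast
  qed
  ultimately show ?thesis
    using P by (auto simp: is_op_lub_def)
qed

end

section \<open>Pullbacks of operator ranges\<close>

text \<open>\<open>range E\<close> is the preimage of \<open>range B\<close> under \<open>A\<close>.
  One inclusion is carried by the witness \<open>U\<close>, as an equation that \<Phi> preserves;
  the other stays pointwise and must be proved over each space.\<close>

definition pullback ::
    "('h::complex_hilbert_space \<Rightarrow> 'h) \<Rightarrow> ('h \<Rightarrow> 'h) \<Rightarrow> ('h \<Rightarrow> 'h) \<Rightarrow> ('h \<Rightarrow> 'h) \<Rightarrow> bool" where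
  "pullback A B E U \<longleftrightarrow> (\<forall>x. A (E x) = B (U x)) \<and> (\<forall>x. A x \<in> range B \<longrightarrow> x \<in> range E)"

text \<open>The hypotheses are algebraic relations between elements and a null projection, so that normal
  homomorphisms preserve them. Here \<open>R\<^sup>2 = AA\<^sup>* + BB\<^sup>*\<close>, and the row
  \<open>(W\<^sub>1, W\<^sub>2)\<close> is the partial isometry in the polar decomposition of the row \<open>(A, B)\<close>.\<close>

lemma mem_range_sqrt_complement_iff:
  fixes A B R W\<^sub>1 W\<^sub>2 E :: "'h::complex_hilbert_space \<Rightarrow> 'h"
  assumes bounded: "bounded_clinear R" "bounded_clinear W\<^sub>1" "bounded_clinear W\<^sub>2" "bounded_clinear E"
    and A: "\<And>x. R (W\<^sub>1 x) = A x" and B: "\<And>x. R (W\<^sub>2 x) = B x"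
    and N1: "\<And>x. null_proj R (W\<^sub>1 x) = 0" and N2: "\<And>x. null_proj R (W\<^sub>2 x) = 0"
    and coisometry: "\<And>x. W\<^sub>1 (cadjoint W\<^sub>1 x) + W\<^sub>2 (cadjoint W\<^sub>2 x) = x - null_proj R x"
    and E: "\<And>x. E (E x) = x - cadjoint W\<^sub>1 (W\<^sub>1 x)" "cadjoint E = E"
  shows "A x \<in> range B \<longleftrightarrow> x \<in> range E"
proof -
  note R = bounded(1) and W1 = bounded(2) and W2 = bounded(3) and bE = bounded(4)
  note W1' = bounded_clinear_cadjoint [OF W1] and W2' = bounded_clinear_cadjoint [OF W2]
  have sa_E: "inner (E u) v = inner u (E v)" for u v
    using inner_cadjoint_left [OF bE, of u v] by (simp add: E(2))
  have norm_E: "(norm (E u))\<^sup>2 = (norm u)\<^sup>2 - (norm (W\<^sub>1 u))\<^sup>2" for u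
    by (simp add: power2_norm_eq_inner sa_E E(1) inner_diff_right inner_cadjoint_right W1)
  have norm_W2: "(norm (cadjoint W\<^sub>2 u))\<^sup>2 = (norm u)\<^sup>2 - (norm (null_proj R u))\<^sup>2 - (norm (cadjoint W\<^sub>1 u))\<^sup>2" for u
  proof -
    have "inner (cadjoint W\<^sub>1 u) (cadjoint W\<^sub>1 u) + inner (cadjoint W\<^sub>2 u) (cadjoint W\<^sub>2 u)
        = inner (W\<^sub>1 (cadjoint W\<^sub>1 u) + W\<^sub>2 (cadjoint W\<^sub>2 u)) u"
      by (simp add: inner_add_left inner_cadjoint_right W1 W2)
    also have "\<dots> = inner u u - inner (null_proj R u) (null_proj R u)"
      by (simp add: coisometry inner_diff_left inner_null_proj_left R null_proj_idem)
    finally show ?thesis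
      by (simp add: power2_norm_eq_inner)
  qed
  \<comment> \<open>\<open>R\<close> is injective on the orthogonal complement of its null space,
    where \<open>W\<^sub>1\<close> and \<open>W\<^sub>2\<close> take their values, so it can be
    cancelled.\<close>
  have "A x \<in> range B \<longleftrightarrow> W\<^sub>1 x \<in> range W\<^sub>2"
  proof -
    have "W\<^sub>1 x = W\<^sub>2 y" if "A x = B y" for y
    proof -
      have "R (W\<^sub>1 x - W\<^sub>2 y) = 0"
        using that by (simp add: bounded_clinear_simps [OF R] A B)
      then have "null_proj R (W\<^sub>1 x - W\<^sub>2 y) = W\<^sub>1 x - W\<^sub>2 y"
        by (rule null_proj_ident [OF R])
      then show ?thesis
        by (simp add: bounded_clinear_simps [OF bounded_clinear_null_proj [OF R]] N1 N2)
    qed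
    moreover have "A x = B y" if "W\<^sub>1 x = W\<^sub>2 y" for y
      using that A [of x] B [of y] by simp
    ultimately show ?thesis
      by blast
  qed
  also have "\<dots> \<longleftrightarrow> x \<in> range E"
  proof
    assume "W\<^sub>1 x \<in> range W\<^sub>2"
    then obtain y where y: "W\<^sub>1 x = W\<^sub>2 y"
      by blast
    \<comment> \<open>Split \<open>x = E (E x) + cadjoint W\<^sub>1 (W\<^sub>1 x)\<close> and
      replace \<open>W\<^sub>1 x\<close> by \<open>W\<^sub>2 y\<close>. The remaining comparison of
      \<open>cadjoint W\<^sub>2 (W\<^sub>1 u)\<close> with \<open>E u\<close> is the expansion of a
      square norm, that of \<open>u - cadjoint W\<^sub>1 (W\<^sub>1 u)\<close>.\<close>
    have "\<bar>inner u x\<bar> \<le> (norm (E x) + norm y) * norm (E u)" for u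
    proof -
      have "(norm (cadjoint W\<^sub>2 (W\<^sub>1 u)))\<^sup>2 = (norm (W\<^sub>1 u))\<^sup>2 - (norm (cadjoint W\<^sub>1 (W\<^sub>1 u)))\<^sup>2"
        by (simp add: norm_W2 N1)
      also have "\<dots> \<le> (norm (E u))\<^sup>2"
      proof -
        have "(norm (u - cadjoint W\<^sub>1 (W\<^sub>1 u)))\<^sup>2
            = (norm u)\<^sup>2 - 2 * (norm (W\<^sub>1 u))\<^sup>2 + (norm (cadjoint W\<^sub>1 (W\<^sub>1 u)))\<^sup>2"
          by (simp add: power2_norm_eq_inner inner_diff_left inner_diff_right inner_cadjoint_left
              inner_cadjoint_right W1 inner_commute)
        then show ?thesis
          using zero_le_power2 [of "norm (u - cadjoint W\<^sub>1 (W\<^sub>1 u))"] by (simp add: norm_E)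
      qed
      finally have le: "norm (cadjoint W\<^sub>2 (W\<^sub>1 u)) \<le> norm (E u)"
        by (rule power2_le_imp_le) simp
      have "inner u x = inner u (E (E x)) + inner u (cadjoint W\<^sub>1 (W\<^sub>2 y))"
        by (simp add: E(1) y inner_diff_right)
      also have "\<dots> = inner (E u) (E x) + inner (cadjoint W\<^sub>2 (W\<^sub>1 u)) y"
        by (simp add: sa_E inner_cadjoint_left inner_cadjoint_right W1 W2)
      finally have "\<bar>inner u x\<bar> \<le> norm (E u) * norm (E x) + norm (cadjoint W\<^sub>2 (W\<^sub>1 u)) * norm y"
        using Cauchy_Schwarz_ineq2 [of "E u" "E x"] Cauchy_Schwarz_ineq2 [of "cadjoint W\<^sub>2 (W\<^sub>1 u)" y]
        by linarith
      also have "\<dots> \<le> norm (E u) * norm (E x) + norm (E u) * norm y"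
        using le by (simp add: mult_right_mono)
      finally show ?thesis
        by (simp add: algebra_simps)
    qed
    then have "x \<in> range (cadjoint E)"
      by (rule in_range_cadjointI [OF bE])
    then show "x \<in> range E"
      by (simp only: E(2))
  next
    assume "x \<in> range E"
    then obtain v where v: "x = E v"
      by blast
    \<comment> \<open>The dual estimate compares \<open>E (cadjoint W\<^sub>1 u)\<close> with
      \<open>cadjoint W\<^sub>2 u\<close>. It expands the square norm of \<open>?Q - ?k\<close>,
      with the range projection of \<open>R\<close> in the place of the identity.\<close>
    have "\<bar>inner u (W\<^sub>1 x)\<bar> \<le> norm v * norm (cadjoint W\<^sub>2 u)" for u
    proof -
      let ?k = "W\<^sub>1 (cadjoint W\<^sub>1 u)" and ?Q = "u - null_proj R u"
      have "(norm (?Q - ?k))\<^sup>2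
          = (norm u)\<^sup>2 - (norm (null_proj R u))\<^sup>2 - 2 * (norm (cadjoint W\<^sub>1 u))\<^sup>2 + (norm ?k)\<^sup>2"
      proof -
        have "inner ?Q ?k = inner (cadjoint W\<^sub>1 u) (cadjoint W\<^sub>1 u)"
          by (simp add: inner_diff_left inner_null_proj_left R N1 inner_cadjoint_left W1)
        moreover have "inner ?Q ?Q = inner u u - inner (null_proj R u) (null_proj R u)"
          by (simp add: inner_diff_left inner_diff_right inner_null_proj_left R null_proj_idem)
        moreover have "inner (?Q - ?k) (?Q - ?k) = inner ?Q ?Q - 2 * inner ?Q ?k + inner ?k ?k"
          by (simp add: inner_diff_left inner_diff_right inner_commute)
        ultimately show ?thesis
          by (simp add: power2_norm_eq_inner)
      qed
      then have "(norm (E (cadjoint W\<^sub>1 u)))\<^sup>2 \<le> (norm (cadjoint W\<^sub>2 u))\<^sup>2"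
        using zero_le_power2 [of "norm (?Q - ?k)"] by (simp add: norm_E norm_W2)
      then have le: "norm (E (cadjoint W\<^sub>1 u)) \<le> norm (cadjoint W\<^sub>2 u)"
        by (rule power2_le_imp_le) simp
      have "\<bar>inner u (W\<^sub>1 x)\<bar> = \<bar>inner (E (cadjoint W\<^sub>1 u)) v\<bar>"
        by (simp add: v sa_E inner_cadjoint_left W1)
      also have "\<dots> \<le> norm (E (cadjoint W\<^sub>1 u)) * norm v"
        by (rule Cauchy_Schwarz_ineq2)
      also have "\<dots> \<le> norm (cadjoint W\<^sub>2 u) * norm v"
        using le by (simp add: mult_right_mono)
      finally show ?thesis
        by (simp add: mult.commute)
    qed
    then have "W\<^sub>1 x \<in> range (cadjoint (cadjoint W\<^sub>2))"
      by (rule in_range_cadjointI [OF W2'])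
    then show "W\<^sub>1 x \<in> range W\<^sub>2"
      by (simp only: cadjoint_cadjoint [OF W2])
  qed
  finally show ?thesis .
qed

section \<open>Polar decomposition of a row inside the algebra\<close>

context vN_algebra
begin

lemma sum_sqrt_mem:
  assumes A: "A \<in> M" and B: "B \<in> M"
  shows "\<exists>R\<in>M. cadjoint R = R \<and> (\<forall>x. R (R x) = A (cadjoint A x) + B (cadjoint B x))"
proof -
  note bA = bounded [OF A] and bB = bounded [OF B]
  obtain a where a: "a > 0" "\<And>x. norm (A x) \<le> a * norm x"
    using bounded_clinear_bound [OF bA] by blast
  obtain b where b: "b > 0" "\<And>x. norm (B x) \<le> b * norm x"
    using bounded_clinear_bound [OF bB] by blast
  \<comment> \<open>\<open>c\<close> bounds the squared norm of the row. Cauchy-Schwarz in the plane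
    gives \<open>(norm (Z x))^2 \<le> c * inner (Z x) x\<close>, which makes
    \<open>1 - Z / c\<close> a contraction; the root of \<open>Z / c\<close> is rescaled by
    \<open>sqrt c\<close> at the end.\<close>
  define c where "c = a\<^sup>2 + b\<^sup>2"
  have c: "c > 0"
    using a b by (simp add: c_def add_pos_pos)
  define Z where "Z = (\<lambda>x. (A \<circ> cadjoint A) x + (B \<circ> cadjoint B) x)"
  have Z: "Z \<in> M"
    unfolding Z_def by (intro add_mem comp_mem cadjoint_mem A B)
  have inner_Z: "inner (Z x) x = (norm (cadjoint A x))\<^sup>2 + (norm (cadjoint B x))\<^sup>2" for x
    by (simp add: Z_def inner_add_left power2_norm_eq_inner inner_cadjoint_right bA bB)
  have sa_Z: "inner (Z x) y = inner x (Z y)" for x y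
    by (simp add: Z_def inner_add_left inner_add_right inner_cadjoint_left
        inner_cadjoint_right bA bB flip: inner_cadjoint_left [OF bA] inner_cadjoint_left [OF bB])
  define D where "D = (\<lambda>x. id x - (1/c) *\<^sub>R Z x)"
  have D: "D \<in> M"
    unfolding D_def by (intro diff_mem id_mem scaleR_mem Z)
  have sa_D: "cadjoint D = D"
    by (rule cadjoint_unique [OF _ bounded [OF D]])
      (simp add: D_def inner_diff_left inner_diff_right sa_Z)
  have "norm (D x) \<le> norm x" for x
  proof (rule power2_le_imp_le)
    let ?p = "norm (cadjoint A x)" and ?q = "norm (cadjoint B x)"
    have "norm (Z x) \<le> a * ?p + b * ?q"
      using norm_triangle_mono [OF a(2) [of "cadjoint A x"] b(2) [of "cadjoint B x"]]
      by (simp add: Z_def)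
    then have "(norm (Z x))\<^sup>2 \<le> (a * ?p + b * ?q)\<^sup>2"
      by (intro power_mono) simp_all
    also have "\<dots> \<le> c * (?p\<^sup>2 + ?q\<^sup>2)"
      using zero_le_power2 [of "a * ?q - b * ?p"]
      by (simp add: c_def power2_eq_square algebra_simps)
    finally have "(norm (Z x))\<^sup>2 \<le> c * inner (Z x) x"
      by (simp add: inner_Z)
    then have "(norm (Z x))\<^sup>2 / c\<^sup>2 \<le> inner (Z x) x / c"
      using c by (simp add: divide_simps power2_eq_square mult.commute)
    moreover have "0 \<le> inner (Z x) x / c"
      using c by (simp add: inner_Z)
    moreover have "(norm (D x))\<^sup>2 = (norm x)\<^sup>2 - 2 * (inner (Z x) x / c) + (norm (Z x))\<^sup>2 / c\<^sup>2"
      unfolding power2_norm_eq_inner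
      by (simp add: D_def inner_diff_left inner_diff_right inner_commute power2_eq_square)
    ultimately show "(norm (D x))\<^sup>2 \<le> (norm x)\<^sup>2"
      by linarith
  qed simp
  then obtain S where S: "S \<in> M" "cadjoint S = S" "\<And>x. S (S x) = x - D x"
    using sqrt_mem [OF D sa_D] by blast
  define R where "R = (\<lambda>x. sqrt c *\<^sub>R S x)"
  have R: "R \<in> M"
    unfolding R_def by (intro scaleR_mem S)
  have "inner (S x) y = inner x (S y)" for x y
    using inner_cadjoint_left [OF bounded [OF S(1)], of x y] S(2) by simp
  then have "cadjoint R = R"
    by (intro cadjoint_unique bounded R) (simp add: R_def)
  moreover have "R (R x) = A (cadjoint A x) + B (cadjoint B x)" for x
    using c S(3) by (simp add: R_def bounded_clinear_simps [OF bounded [OF S(1)]] D_def Z_def)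
  ultimately show ?thesis
    using R by blast
qed

text \<open>\<open>norm (R u)\<close> dominates the norms of \<open>cadjoint A u\<close> and
  \<open>cadjoint B u\<close>, so the ranges of \<open>A\<close> and \<open>B\<close> lie in that of
  \<open>R\<close>. The factors are the Douglas factors normalised to be orthogonal to the null
  space of \<open>R\<close>.\<close>

lemma polar_row:
  assumes A: "A \<in> M" and B: "B \<in> M"
  obtains R W\<^sub>1 W\<^sub>2 where "R \<in> M" "W\<^sub>1 \<in> M" "W\<^sub>2 \<in> M"
    "\<And>x. R (W\<^sub>1 x) = A x" "\<And>x. R (W\<^sub>2 x) = B x"
    "\<And>x. null_proj R (W\<^sub>1 x) = 0" "\<And>x. null_proj R (W\<^sub>2 x) = 0"
    "\<And>x. W\<^sub>1 (cadjoint W\<^sub>1 x) + W\<^sub>2 (cadjoint W\<^sub>2 x) = x - null_proj R x"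
proof -
  note bA = bounded [OF A] and bB = bounded [OF B]
  obtain R where R: "R \<in> M" "cadjoint R = R" "\<And>x. R (R x) = A (cadjoint A x) + B (cadjoint B x)"
    using sum_sqrt_mem [OF A B] by blast
  note bR = bounded [OF R(1)] and bN = bounded_clinear_null_proj [OF bounded [OF R(1)]]
  have sa_R: "inner (R x) y = inner x (R y)" for x y
    using inner_cadjoint_left [OF bR, of x y] R(2) by simp
  have norm_R: "(norm (R u))\<^sup>2 = (norm (cadjoint A u))\<^sup>2 + (norm (cadjoint B u))\<^sup>2" for u
    by (simp add: power2_norm_eq_inner sa_R R(3) inner_add_right inner_cadjoint_left bA bB)
  have range_le: "range C \<subseteq> range R"
    if C: "C \<in> M" and le: "\<And>u. (norm (cadjoint C u))\<^sup>2 \<le> (norm (R u))\<^sup>2" for C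
  proof -
    have "C x \<in> range R" for x
    proof -
      have "\<bar>inner u (C x)\<bar> \<le> norm x * norm (R u)" for u
      proof -
        have "norm (cadjoint C u) \<le> norm (R u)"
          using le by (rule power2_le_imp_le) simp
        then have "norm (cadjoint C u) * norm x \<le> norm x * norm (R u)"
          by (simp add: mult.commute mult_left_mono)
        moreover have "\<bar>inner u (C x)\<bar> \<le> norm (cadjoint C u) * norm x"
          using Cauchy_Schwarz_ineq2 [of "cadjoint C u" x]
          by (simp add: inner_cadjoint_left bounded C)
        ultimately show ?thesis
          by linarith
      qed
      then have "C x \<in> range (cadjoint R)"
        by (rule in_range_cadjointI [OF bR])
      then show ?thesis
        by (simp only: R(2))
    qed
    then show ?thesis
      by blast
  qed
  obtain W1 where W1: "W1 \<in> M" "\<And>x. R (W1 x) = A x" "\<And>x. null_proj R (W1 x) = 0"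
    using range_subset_factor [OF A R(1) range_le [OF A]] norm_R by auto
  obtain W2 where W2: "W2 \<in> M" "\<And>x. R (W2 x) = B x" "\<And>x. null_proj R (W2 x) = 0"
    using range_subset_factor [OF B R(1) range_le [OF B]] norm_R by auto
  note bW1 = bounded [OF W1(1)] and bW2 = bounded [OF W2(1)]
  \<comment> \<open>\<open>T\<close> is the defect of the last relation. It vanishes on
    \<open>range R\<close>: applying \<open>R\<close> to \<open>T (R y)\<close> gives
    \<open>A (cadjoint A y) + B (cadjoint B y) - R (R y) = 0\<close>, and \<open>T (R y)\<close> is
    orthogonal to the null space of \<open>R\<close>. On that null space the adjoints of both
    factors vanish.\<close>
  define T where "T = (\<lambda>x. ((W1 \<circ> cadjoint W1) x + (W2 \<circ> cadjoint W2) x) - (id x - null_proj R x))"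
  have "T \<in> M"
    unfolding T_def by (intro diff_mem add_mem comp_mem cadjoint_mem id_mem null_proj_mem W1 W2 R)
  note bT = bounded [OF this]
  have W_R: "cadjoint W (R y) = cadjoint C y"
    if "W \<in> M" "C \<in> M" "\<And>x. R (W x) = C x" for W C y
    by (rule inner_eqI) (use that in \<open>simp add: inner_cadjoint_right bounded flip: sa_R\<close>)
  have W_N: "cadjoint W (null_proj R y) = 0" if "W \<in> M" "\<And>x. null_proj R (W x) = 0" for W y
    by (rule inner_eqI)
      (use that in \<open>simp add: inner_cadjoint_right bounded flip: inner_null_proj_left [OF bR]\<close>)
  have N_R: "null_proj R (R y) = 0" for y
    by (rule inner_eqI) (simp add: apply_null_proj [OF bR] flip: inner_null_proj_left [OF bR] sa_R)
  have T_R: "T (R y) = 0" for y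
  proof -
    have "R (T (R y)) = 0"
      using W1 W2 R(3) [of y] N_R [of y]
      by (simp add: T_def bounded_clinear_simps [OF bR] W_R [OF W1(1) A W1(2)] W_R [OF W2(1) B W2(2)])
    then have "null_proj R (T (R y)) = T (R y)"
      by (rule null_proj_ident [OF bR])
    moreover have "null_proj R (T (R y)) = 0"
      by (simp add: T_def bounded_clinear_simps [OF bN] W1(3) W2(3) null_proj_idem [OF bR])
    ultimately show ?thesis
      by simp
  qed
  have "T x = 0" for x
  proof -
    have "closure (range R) \<subseteq> null_space T"
      by (rule closure_minimal) (use T_R closed_null_space [OF bT] in \<open>auto simp: null_space_def\<close>)
    moreover have "x - null_proj R x \<in> closure (range R)"
      using closure_range_cadjoint_iff [OF bR, of "x - null_proj R x"] R(2)
      by (simp add: bounded_clinear_simps [OF bN] null_proj_idem [OF bR])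
    ultimately have "T (x - null_proj R x) = 0"
      by (auto simp: null_space_def)
    moreover have "T (null_proj R x) = 0"
      by (simp add: T_def W_N [OF W1(1,3)] W_N [OF W2(1,3)] null_proj_idem [OF bR]
          bounded_clinear_simps [OF bW1] bounded_clinear_simps [OF bW2])
    ultimately show ?thesis
      by (simp add: bounded_clinear_simps [OF bT])
  qed
  then have "W1 (cadjoint W1 x) + W2 (cadjoint W2 x) = x - null_proj R x" for x
    by (simp add: T_def)
  then show ?thesis
    by (rule that [OF R(1) W1(1) W2(1) W1(2) W2(2) W1(3) W2(3)])
qed

text \<open>The bound is asked of the adjoint because the relation for the row supplies it there; it
  passes to \<open>W\<close> itself.\<close>

lemma sqrt_complement_mem:
  assumes W: "W \<in> M" and contr: "\<And>x. norm (cadjoint W x) \<le> norm x"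
  shows "\<exists>E\<in>M. cadjoint E = E \<and> (\<forall>x. E (E x) = x - cadjoint W (W x))"
proof -
  note bW = bounded [OF W]
  have "norm (W x) \<le> norm x" for x
  proof (cases "W x = 0")
    case False
    have "norm (W x) * norm (W x) = inner (cadjoint W (W x)) x"
      by (simp add: inner_cadjoint_left bW flip: power2_norm_eq_inner power2_eq_square)
    also have "\<dots> \<le> norm (W x) * norm x"
      by (rule order_trans [OF norm_cauchy_schwarz]) (simp add: contr mult_right_mono)
    finally show ?thesis
      using False by simp
  qed simp
  then have "norm ((cadjoint W \<circ> W) x) \<le> norm x" for x
    using contr order_trans by fastforce
  moreover have "cadjoint (cadjoint W \<circ> W) = cadjoint W \<circ> W"
    by (simp add: cadjoint_comp cadjoint_cadjoint bounded_clinear_cadjoint bW)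
  ultimately show ?thesis
    using sqrt_mem [of "cadjoint W \<circ> W"] W by (simp add: comp_mem cadjoint_mem)
qed

end

section \<open>Normal homomorphisms\<close>

locale normal_star_hom = M: vN_algebra M + N: vN_algebra N
  for M :: "('h::complex_hilbert_space \<Rightarrow> 'h) set"
    and N :: "('k::complex_hilbert_space \<Rightarrow> 'k) set" +
  fixes \<Phi> :: "('h \<Rightarrow> 'h) \<Rightarrow> 'k \<Rightarrow> 'k"
  assumes hom: "unital_star_homomorphism M N \<Phi>" and normal: "normal_map M N \<Phi>"
begin

lemma
  shows hom_mem: "A \<in> M \<Longrightarrow> \<Phi> A \<in> N"
    and hom_id: "\<Phi> id = id"
    and hom_add: "A \<in> M \<Longrightarrow> B \<in> M \<Longrightarrow> \<Phi> (\<lambda>x. A x + B x) = (\<lambda>y. \<Phi> A y + \<Phi> B y)"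
    and hom_scaleC: "A \<in> M \<Longrightarrow> \<Phi> (\<lambda>x. c *\<^sub>C A x) = (\<lambda>y. c *\<^sub>C \<Phi> A y)"
    and hom_comp: "A \<in> M \<Longrightarrow> B \<in> M \<Longrightarrow> \<Phi> (A \<circ> B) = \<Phi> A \<circ> \<Phi> B"
    and hom_cadjoint: "A \<in> M \<Longrightarrow> \<Phi> (cadjoint A) = cadjoint (\<Phi> A)"
  using hom by (auto simp: unital_star_homomorphism_def)

lemma hom_diff: "A \<in> M \<Longrightarrow> B \<in> M \<Longrightarrow> \<Phi> (\<lambda>x. A x - B x) = (\<lambda>y. \<Phi> A y - \<Phi> B y)"
  using hom_add [of A "\<lambda>x. (-1) *\<^sub>C B x"] hom_scaleC [of B "-1"] M.scaleC_mem [of B "-1"] by simp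

lemma hom_scaleR: "A \<in> M \<Longrightarrow> \<Phi> (\<lambda>x. r *\<^sub>R A x) = (\<lambda>y. r *\<^sub>R \<Phi> A y)"
  using hom_scaleC by (simp add: scaleR_eq_scaleC)

lemma hom_funpow: "A \<in> M \<Longrightarrow> \<Phi> (A ^^ n) = \<Phi> A ^^ n"
  by (induction n) (simp_all add: hom_id hom_comp M.funpow_mem)

lemma hom_bounded: "A \<in> M \<Longrightarrow> bounded_clinear (\<Phi> A)"
  by (simp add: N.bounded hom_mem)

lemma hom_support_approx:
  assumes B: "B \<in> M"
  shows "\<Phi> (support_approx c B n) = support_approx c (\<Phi> B) n"
proof -
  note mem = M.id_mem M.comp_mem M.funpow_mem M.scaleR_mem M.cadjoint_mem B
  have D: "null_iter c B \<in> M"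
    unfolding null_iter_def by (intro M.diff_mem mem)
  have "\<Phi> (null_iter c B) = null_iter c (\<Phi> B)"
    unfolding null_iter_def by (simp only: hom_diff hom_id hom_scaleR hom_comp hom_cadjoint mem)
  then show ?thesis
    unfolding support_approx_def using D by (simp only: hom_diff hom_id hom_comp hom_funpow mem)
qed

text \<open>\<Phi> maps the approximants of \<open>B\<close> to those of \<open>\<Phi> B\<close>, so
  by normality the image of \<open>1 - null_proj B\<close> and
  \<open>1 - null_proj (\<Phi> B)\<close> are least upper bounds of the same set.\<close>

lemma hom_null_proj:
  assumes B: "B \<in> M"
  shows "\<Phi> (null_proj B) = null_proj (\<Phi> B)"
proof -
  note bB = M.bounded [OF B] and b\<Phi>B = hom_bounded [OF B]
  obtain a where a: "a > 0" "\<And>x. norm (cadjoint B x) \<le> a * norm x"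
    using bounded_clinear_bound [OF bounded_clinear_cadjoint [OF bB]] by blast
  obtain b where b: "b > 0" "\<And>y. norm (cadjoint (\<Phi> B) y) \<le> b * norm y"
    using bounded_clinear_bound [OF bounded_clinear_cadjoint [OF b\<Phi>B]] by blast
  \<comment> \<open>One constant has to dominate both adjoints, since the approximants over the two
    spaces must share the same \<open>c\<close>.\<close>
  define c where "c = a\<^sup>2 + b\<^sup>2"
  have c: "0 < c"
    using a b by (simp add: c_def add_pos_pos)
  have c_a: "(norm (cadjoint B x))\<^sup>2 \<le> c * (norm x)\<^sup>2" for x
  proof -
    have "(norm (cadjoint B x))\<^sup>2 \<le> (a * norm x)\<^sup>2"
      by (intro power_mono a) simp
    then show ?thesis
      by (simp add: c_def power_mult_distrib distrib_right add_increasing2)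
  qed
  have c_b: "(norm (cadjoint (\<Phi> B) y))\<^sup>2 \<le> c * (norm y)\<^sup>2" for y
  proof -
    have "(norm (cadjoint (\<Phi> B) y))\<^sup>2 \<le> (b * norm y)\<^sup>2"
      by (intro power_mono b) simp
    then show ?thesis
      by (simp add: c_def power_mult_distrib distrib_right add_increasing)
  qed
  note vM = M.vN_algebra_axioms and vN = N.vN_algebra_axioms
  let ?S = "range (support_approx c B)"
  have S_sub: "?S \<subseteq> selfadjoint_part M"
    using support_approx_selfadjoint [OF bB c c_a vM B] by blast
  have directed: "\<exists>Z\<in>?S. op_le X Z \<and> op_le Y Z" if XY: "X \<in> ?S" "Y \<in> ?S" for X Y
  proof -
    obtain m n where "X = support_approx c B m" "Y = support_approx c B n"
      using XY by blast
    then show ?thesis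
      using support_approx_directed [OF bB c c_a vM B] by (metis max.cobounded1 max.cobounded2 rangeI)
  qed
  have "is_op_lub N (\<Phi> ` ?S) (\<Phi> (\<lambda>x. id x - null_proj B x))"
  proof (rule normal [unfolded normal_map_def, rule_format], intro conjI ballI)
    show "is_op_lub M ?S (\<lambda>x. id x - null_proj B x)"
      by (rule is_op_lub_support_approx [OF bB c c_a vM B])
  qed (use S_sub directed in auto)
  moreover have "\<Phi> ` ?S = range (support_approx c (\<Phi> B))"
    by (simp add: image_image hom_support_approx B)
  ultimately have "\<Phi> (\<lambda>x. id x - null_proj B x) = (\<lambda>y. id y - null_proj (\<Phi> B) y)"
    using is_op_lub_support_approx [OF b\<Phi>B c c_b vN hom_mem [OF B]] is_op_lub_unique [OF vN]
    by metis
  then have "(\<lambda>y. id y - \<Phi> (null_proj B) y) = (\<lambda>y. id y - null_proj (\<Phi> B) y)"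
    by (simp only: hom_diff M.id_mem M.null_proj_mem B hom_id)
  then show ?thesis
    by (simp add: fun_eq_iff)
qed

lemma hom_range_proj: "B \<in> M \<Longrightarrow> \<Phi> (range_proj B) = range_proj (\<Phi> B)"
  by (simp only: M.range_proj_alt N.range_proj_alt hom_mem hom_diff hom_id hom_null_proj
      hom_cadjoint M.id_mem M.null_proj_mem M.cadjoint_mem)

text \<open>The inclusion is equivalent to the equation
  \<open>A \<circ> (1 - null_proj B) = A\<close>, which \<Phi> preserves.\<close>

lemma hom_null_space_mono:
  assumes A: "A \<in> M" and B: "B \<in> M" and sub: "null_space B \<subseteq> null_space A"
  shows "null_space (\<Phi> B) \<subseteq> null_space (\<Phi> A)"
proof
  fix y assume y: "y \<in> null_space (\<Phi> B)"
  note bA = M.bounded [OF A] and bB = M.bounded [OF B]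
  have "A (null_proj B x) = 0" for x
    using apply_null_proj [OF bB, of x] sub by (auto simp: null_space_def)
  then have "A \<circ> (\<lambda>x. id x - null_proj B x) = A"
    by (simp add: fun_eq_iff bounded_clinear_simps [OF bA])
  then have "\<Phi> A = \<Phi> (A \<circ> (\<lambda>x. id x - null_proj B x))"
    by simp
  also have "\<dots> = \<Phi> A \<circ> (\<lambda>y. id y - null_proj (\<Phi> B) y)"
    by (simp only: hom_comp hom_diff hom_id hom_null_proj A B M.diff_mem M.id_mem M.null_proj_mem)
  finally have "\<Phi> A y = \<Phi> A (y - null_proj (\<Phi> B) y)"
    by (metis comp_apply id_apply)
  also have "\<dots> = 0"
    using y null_proj_ident [OF hom_bounded [OF B], of y]
    by (simp add: null_space_def bounded_clinear_simps [OF hom_bounded [OF A]])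
  finally show "y \<in> null_space (\<Phi> A)"
    by (simp add: null_space_def)
qed

lemma hom_comp_eq:
  assumes "A \<in> M" "B \<in> M" "C \<in> M" and "\<And>x. A (B x) = C x"
  shows "\<Phi> A (\<Phi> B y) = \<Phi> C y"
proof -
  have "A \<circ> B = C"
    using assms(4) by auto
  then show ?thesis
    using hom_comp [OF assms(1,2)] by (metis comp_apply)
qed

text \<open>\<open>E\<close> and \<open>U\<close> are constructed over \<open>M\<close> only. The
  preimage criterion is then invoked for the original operators and again for their images, which
  satisfy the same identities.\<close>

lemma pullback_exists:
  assumes A: "A \<in> M" and B: "B \<in> M"
  obtains E U where "E \<in> M" "U \<in> M" "pullback A B E U" "pullback (\<Phi> A) (\<Phi> B) (\<Phi> E) (\<Phi> U)"
proof -
  obtain R W\<^sub>1 W\<^sub>2 where mem: "R \<in> M" "W\<^sub>1 \<in> M" "W\<^sub>2 \<in> M"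
    and RW: "\<And>x. R (W\<^sub>1 x) = A x" "\<And>x. R (W\<^sub>2 x) = B x"
    and NW: "\<And>x. null_proj R (W\<^sub>1 x) = 0" "\<And>x. null_proj R (W\<^sub>2 x) = 0"
    and cois: "\<And>x. W\<^sub>1 (cadjoint W\<^sub>1 x) + W\<^sub>2 (cadjoint W\<^sub>2 x) = x - null_proj R x"
    using M.polar_row [OF A B] by metis
  note bR = M.bounded [OF mem(1)] and bW1 = M.bounded [OF mem(2)] and bW2 = M.bounded [OF mem(3)]
  have "norm (cadjoint W\<^sub>1 x) \<le> norm x" for x
  proof (rule power2_le_imp_le)
    have "inner (cadjoint W\<^sub>1 x) (cadjoint W\<^sub>1 x) + inner (cadjoint W\<^sub>2 x) (cadjoint W\<^sub>2 x)
        = inner (W\<^sub>1 (cadjoint W\<^sub>1 x) + W\<^sub>2 (cadjoint W\<^sub>2 x)) x"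
      by (simp add: inner_add_left inner_cadjoint_right bW1 bW2)
    also have "\<dots> = inner x x - inner (null_proj R x) (null_proj R x)"
      by (simp add: cois inner_diff_left inner_null_proj_left bR null_proj_idem)
    finally show "(norm (cadjoint W\<^sub>1 x))\<^sup>2 \<le> (norm x)\<^sup>2"
      using inner_ge_zero [of "cadjoint W\<^sub>2 x"] inner_ge_zero [of "null_proj R x"]
      unfolding power2_norm_eq_inner by linarith
  qed simp
  then obtain E where E: "E \<in> M" "cadjoint E = E" "\<And>x. E (E x) = x - cadjoint W\<^sub>1 (W\<^sub>1 x)"
    using M.sqrt_complement_mem [OF mem(2)] by blast
  have iff: "A x \<in> range B \<longleftrightarrow> x \<in> range E" for x
    by (rule mem_range_sqrt_complement_iff [OF bR bW1 bW2 M.bounded [OF E(1)] RW NW cois E(3,2)])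
  have zero_W: "\<Phi> (null_proj R) (\<Phi> W y) = 0" if W: "W \<in> M" "\<And>x. null_proj R (W x) = 0" for W y
  proof -
    \<comment> \<open>The zero operator is written as \<open>W - W\<close> so that its image can be
      computed from \<open>hom_diff\<close>.\<close>
    have "\<Phi> (null_proj R) (\<Phi> W y) = \<Phi> (\<lambda>x. W x - W x) y"
      by (rule hom_comp_eq) (use W mem M.null_proj_mem M.diff_mem [OF W(1) W(1)] in auto)
    then show ?thesis
      using hom_diff [OF W(1) W(1)] by simp
  qed
  have \<Phi>_iff: "\<Phi> A y \<in> range (\<Phi> B) \<longleftrightarrow> y \<in> range (\<Phi> E)" for y
  proof (rule mem_range_sqrt_complement_iff [of "\<Phi> R" "\<Phi> W\<^sub>1" "\<Phi> W\<^sub>2"])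
    show "\<Phi> R (\<Phi> W\<^sub>1 x) = \<Phi> A x" "\<Phi> R (\<Phi> W\<^sub>2 x) = \<Phi> B x" for x
      by (rule hom_comp_eq; use mem A B RW in blast)+
    show "null_proj (\<Phi> R) (\<Phi> W\<^sub>1 x) = 0" "null_proj (\<Phi> R) (\<Phi> W\<^sub>2 x) = 0" for x
      using zero_W mem NW by (simp_all add: hom_null_proj)
    have "(\<lambda>x. (W\<^sub>1 \<circ> cadjoint W\<^sub>1) x + (W\<^sub>2 \<circ> cadjoint W\<^sub>2) x) = (\<lambda>x. id x - null_proj R x)"
      using cois by simp
    from arg_cong [OF this, of \<Phi>]
    have "(\<lambda>x. (\<Phi> W\<^sub>1 \<circ> cadjoint (\<Phi> W\<^sub>1)) x + (\<Phi> W\<^sub>2 \<circ> cadjoint (\<Phi> W\<^sub>2)) x)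
        = (\<lambda>x. id x - null_proj (\<Phi> R) x)"
      by (simp only: hom_add hom_diff hom_comp hom_cadjoint hom_id hom_null_proj M.id_mem
          M.comp_mem M.cadjoint_mem M.null_proj_mem mem)
    then show "\<Phi> W\<^sub>1 (cadjoint (\<Phi> W\<^sub>1) x) + \<Phi> W\<^sub>2 (cadjoint (\<Phi> W\<^sub>2) x) = x - null_proj (\<Phi> R) x" for x
      by (simp add: fun_eq_iff)
    have "E \<circ> E = (\<lambda>x. id x - (cadjoint W\<^sub>1 \<circ> W\<^sub>1) x)"
      using E(3) by auto
    from arg_cong [OF this, of \<Phi>]
    have "\<Phi> E \<circ> \<Phi> E = (\<lambda>x. id x - (cadjoint (\<Phi> W\<^sub>1) \<circ> \<Phi> W\<^sub>1) x)"
      by (simp only: hom_diff hom_comp hom_cadjoint hom_id M.id_mem M.comp_mem M.cadjoint_mem mem E(1))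
    then show "\<Phi> E (\<Phi> E x) = x - cadjoint (\<Phi> W\<^sub>1) (\<Phi> W\<^sub>1 x)" for x
      by (simp add: fun_eq_iff)
    show "cadjoint (\<Phi> E) = \<Phi> E"
      using hom_cadjoint [OF E(1)] E(2) by simp
  qed (simp_all add: hom_bounded mem E)
  have "range (A \<circ> E) \<subseteq> range B"
    using iff by auto
  then obtain U where U: "U \<in> M" "\<And>x. B (U x) = (A \<circ> E) x" "\<And>x. null_proj B (U x) = 0"
    by (rule M.range_subset_factor [OF M.comp_mem [OF A E(1)] B]) (rule that)
  have "\<Phi> B (\<Phi> U y) = \<Phi> A (\<Phi> E y)" for y
    using hom_comp_eq [OF B U(1) M.comp_mem [OF A E(1)] U(2), of y]
    unfolding hom_comp [OF A E(1)] by simp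
  then have "pullback (\<Phi> A) (\<Phi> B) (\<Phi> E) (\<Phi> U)"
    using \<Phi>_iff by (auto simp: pullback_def)
  moreover have "pullback A B E U"
    using iff U by (auto simp: pullback_def)
  ultimately show ?thesis
    using E(1) U(1) that by blast
qed

end

section \<open>Quotients of bounded operators\<close>

lemma map_eqI:
  assumes "\<And>y z. f y = Some z \<longleftrightarrow> g y = Some z"
  shows "f = g"
proof
  show "f y = g y" for y
    using assms by (metis not_Some_eq)
qed

text \<open>No algebra appears, so the formulas below apply both to a pair in \<open>M\<close> and
  to its image under \<Phi>.\<close>

definition quotient_pair ::
    "('h::complex_hilbert_space \<Rightarrow> 'h) \<Rightarrow> ('h \<Rightarrow> 'h) \<Rightarrow> bool" where
  "quotient_pair A B \<longleftrightarrow>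
     bounded_clinear A \<and> bounded_clinear B \<and> null_space B \<subseteq> null_space A"

lemma quotient_pair_eq:
  assumes "quotient_pair A B" "B x = B y"
  shows "A x = A y"
proof -
  have b: "bounded_clinear A" "bounded_clinear B"
    using assms(1) by (simp_all add: quotient_pair_def)
  have "x - y \<in> null_space B"
    using assms(2) by (simp add: null_space_def bounded_clinear_simps [OF b(2)])
  then have "x - y \<in> null_space A"
    using assms(1) by (auto simp: quotient_pair_def)
  then show ?thesis
    by (simp add: null_space_def bounded_clinear_simps [OF b(1)])
qed

lemma quotient_op_apply:
  assumes "quotient_pair A B"
  shows "quotient_op A B (B x) = Some (A x)"
proof -
  have "(THE z. \<exists>u. B u = B x \<and> z = A u) = A x"
    using quotient_pair_eq [OF assms] by (intro the_equality) blast+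
  then show ?thesis
    by (simp add: quotient_op_def)
qed

lemma quotient_op_eq_Some_iff:
  assumes "quotient_pair A B"
  shows "quotient_op A B y = Some z \<longleftrightarrow> (\<exists>x. B x = y \<and> A x = z)"
proof
  assume *: "quotient_op A B y = Some z"
  then have "y \<in> range B"
    by (auto simp: quotient_op_def split: if_splits)
  then show "\<exists>x. B x = y \<and> A x = z"
    using * quotient_op_apply [OF assms] by auto
qed (use quotient_op_apply [OF assms] in auto)

lemma dom_quotient_op: "dom (quotient_op A B) = range B"
  by (auto simp: quotient_op_def split: if_splits)

lemma ran_quotient_op: "quotient_pair A B \<Longrightarrow> ran (quotient_op A B) = range A"
  by (auto simp: ran_def quotient_op_eq_Some_iff)

section \<open>Sums and products of quotients\<close>

lemma op_add_eq_Some_iff: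
  "op_add S T y = Some z \<longleftrightarrow> (\<exists>a b. S y = Some a \<and> T y = Some b \<and> a + b = z)"
  by (auto simp: op_add_def)

text \<open>A vector \<open>B\<^sub>2 v\<close> lies in the first domain iff \<open>v\<close> can be
  written as \<open>E x\<close>; then \<open>U x\<close> is a preimage of it under
  \<open>B\<^sub>1\<close>, and the two summands are \<open>A\<^sub>1 (U x)\<close> and
  \<open>A\<^sub>2 (E x)\<close>.\<close>

lemma op_add_quotient:
  assumes q1: "quotient_pair A\<^sub>1 B\<^sub>1" and q2: "quotient_pair A\<^sub>2 B\<^sub>2"
    and E: "bounded_clinear E" and U: "bounded_clinear U" and pb: "pullback B\<^sub>2 B\<^sub>1 E U"
  shows "quotient_pair (\<lambda>x. (A\<^sub>1 \<circ> U) x + (A\<^sub>2 \<circ> E) x) (B\<^sub>2 \<circ> E)" (is "quotient_pair ?A ?B")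
    and "op_add (quotient_op A\<^sub>1 B\<^sub>1) (quotient_op A\<^sub>2 B\<^sub>2)
      = quotient_op (\<lambda>x. (A\<^sub>1 \<circ> U) x + (A\<^sub>2 \<circ> E) x) (B\<^sub>2 \<circ> E)"
proof -
  have b: "bounded_clinear A\<^sub>1" "bounded_clinear B\<^sub>1" "bounded_clinear A\<^sub>2" "bounded_clinear B\<^sub>2"
    and null: "null_space B\<^sub>1 \<subseteq> null_space A\<^sub>1" "null_space B\<^sub>2 \<subseteq> null_space A\<^sub>2"
    using q1 q2 by (simp_all add: quotient_pair_def)
  have BU: "B\<^sub>1 (U x) = B\<^sub>2 (E x)" for x
    using pb by (simp add: pullback_def)
  have "A\<^sub>1 (U x) + A\<^sub>2 (E x) = 0" if "B\<^sub>2 (E x) = 0" for x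
  proof -
    have "E x \<in> null_space A\<^sub>2" "U x \<in> null_space A\<^sub>1"
      using that BU [of x] null by (auto simp: null_space_def)
    then show ?thesis
      by (simp add: null_space_def)
  qed
  then have "null_space ?B \<subseteq> null_space ?A"
    by (auto simp: null_space_def)
  then show q: "quotient_pair ?A ?B"
    unfolding quotient_pair_def
    by (intro conjI bounded_clinear_add bounded_clinear_comp b E U)
  show "op_add (quotient_op A\<^sub>1 B\<^sub>1) (quotient_op A\<^sub>2 B\<^sub>2) = quotient_op ?A ?B"
  proof (rule map_eqI)
    fix y z
    have "(\<exists>u v. B\<^sub>1 u = y \<and> B\<^sub>2 v = y \<and> A\<^sub>1 u + A\<^sub>2 v = z)
        \<longleftrightarrow> (\<exists>x. B\<^sub>2 (E x) = y \<and> A\<^sub>1 (U x) + A\<^sub>2 (E x) = z)"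
    proof
      assume "\<exists>u v. B\<^sub>1 u = y \<and> B\<^sub>2 v = y \<and> A\<^sub>1 u + A\<^sub>2 v = z"
      then obtain u v where uv: "B\<^sub>1 u = y" "B\<^sub>2 v = y" "A\<^sub>1 u + A\<^sub>2 v = z"
        by blast
      then have "B\<^sub>2 v \<in> range B\<^sub>1"
        by (metis rangeI)
      then obtain x where x: "v = E x"
        using pb by (auto simp: pullback_def)
      then have "A\<^sub>1 (U x) = A\<^sub>1 u"
        using uv BU [of x] by (intro quotient_pair_eq [OF q1]) simp
      then show "\<exists>x. B\<^sub>2 (E x) = y \<and> A\<^sub>1 (U x) + A\<^sub>2 (E x) = z"
        using uv x by auto
    qed (use BU in blast)
    then show "op_add (quotient_op A\<^sub>1 B\<^sub>1) (quotient_op A\<^sub>2 B\<^sub>2) y = Some z \<longleftrightarrow> quotient_op ?A ?B y = Some z"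
      unfolding op_add_eq_Some_iff quotient_op_eq_Some_iff [OF q1] quotient_op_eq_Some_iff [OF q2]
        quotient_op_eq_Some_iff [OF q]
      unfolding comp_apply by blast
  qed
qed

text \<open>\<open>B\<^sub>2 v\<close> lies in the domain of the product iff
  \<open>A\<^sub>2 v\<close> lies in \<open>range B\<^sub>1\<close>, so the preimage is now taken
  under \<open>A\<^sub>2\<close>.\<close>

lemma map_comp_quotient:
  assumes q1: "quotient_pair A\<^sub>1 B\<^sub>1" and q2: "quotient_pair A\<^sub>2 B\<^sub>2"
    and E: "bounded_clinear E" and U: "bounded_clinear U" and pb: "pullback A\<^sub>2 B\<^sub>1 E U"
  shows "quotient_pair (A\<^sub>1 \<circ> U) (B\<^sub>2 \<circ> E)" (is "quotient_pair ?A ?B")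
    and "quotient_op A\<^sub>1 B\<^sub>1 \<circ>\<^sub>m quotient_op A\<^sub>2 B\<^sub>2 = quotient_op (A\<^sub>1 \<circ> U) (B\<^sub>2 \<circ> E)"
proof -
  have b: "bounded_clinear A\<^sub>1" "bounded_clinear B\<^sub>1" "bounded_clinear A\<^sub>2" "bounded_clinear B\<^sub>2"
    and null: "null_space B\<^sub>1 \<subseteq> null_space A\<^sub>1" "null_space B\<^sub>2 \<subseteq> null_space A\<^sub>2"
    using q1 q2 by (simp_all add: quotient_pair_def)
  have BU: "B\<^sub>1 (U x) = A\<^sub>2 (E x)" for x
    using pb by (simp add: pullback_def)
  have "A\<^sub>1 (U x) = 0" if "B\<^sub>2 (E x) = 0" for x
  proof -
    have "E x \<in> null_space A\<^sub>2"
      using that null by (auto simp: null_space_def)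
    then have "U x \<in> null_space A\<^sub>1"
      using BU [of x] null by (auto simp: null_space_def)
    then show ?thesis
      by (simp add: null_space_def)
  qed
  then have "null_space ?B \<subseteq> null_space ?A"
    by (auto simp: null_space_def)
  then show q: "quotient_pair ?A ?B"
    unfolding quotient_pair_def by (intro conjI bounded_clinear_comp b E U)
  show "quotient_op A\<^sub>1 B\<^sub>1 \<circ>\<^sub>m quotient_op A\<^sub>2 B\<^sub>2 = quotient_op ?A ?B"
  proof (rule map_eqI)
    fix y z
    have "(\<exists>v u. B\<^sub>2 v = y \<and> B\<^sub>1 u = A\<^sub>2 v \<and> A\<^sub>1 u = z) \<longleftrightarrow> (\<exists>x. B\<^sub>2 (E x) = y \<and> A\<^sub>1 (U x) = z)"
    proof
      assume "\<exists>v u. B\<^sub>2 v = y \<and> B\<^sub>1 u = A\<^sub>2 v \<and> A\<^sub>1 u = z"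
      then obtain u v where uv: "B\<^sub>2 v = y" "B\<^sub>1 u = A\<^sub>2 v" "A\<^sub>1 u = z"
        by blast
      then have "A\<^sub>2 v \<in> range B\<^sub>1"
        by (metis rangeI)
      then obtain x where x: "v = E x"
        using pb by (auto simp: pullback_def)
      then have "A\<^sub>1 (U x) = A\<^sub>1 u"
        using uv BU [of x] by (intro quotient_pair_eq [OF q1]) simp
      then show "\<exists>x. B\<^sub>2 (E x) = y \<and> A\<^sub>1 (U x) = z"
        using uv x by auto
    qed (use BU in blast)
    then show "(quotient_op A\<^sub>1 B\<^sub>1 \<circ>\<^sub>m quotient_op A\<^sub>2 B\<^sub>2) y = Some z \<longleftrightarrow> quotient_op ?A ?B y = Some z"
      by (auto simp: map_comp_Some_iff quotient_op_eq_Some_iff q q1 q2)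
  qed
qed

text \<open>The null space of \<open>A/B\<close> is the image of \<open>null_space A\<close> under
  \<open>B\<close>, hence the range of \<open>B \<circ> null_proj A\<close>. This makes the
  projection in the Kaufman inverse a range projection of an element of the algebra.\<close>

lemma kaufman_inverse_quotient:
  assumes q: "quotient_pair A B"
  shows "quotient_pair (\<lambda>x. B x - (range_proj (B \<circ> null_proj A) \<circ> B) x) A"
      (is "quotient_pair ?C A")
    and "kaufman_inverse (quotient_op A B)
      = quotient_op (\<lambda>x. B x - (range_proj (B \<circ> null_proj A) \<circ> B) x) A"
proof -
  have b: "bounded_clinear A" "bounded_clinear B"
    using q by (simp_all add: quotient_pair_def)
  let ?F = "range_proj (B \<circ> null_proj A)"
  note bBN = bounded_clinear_comp [OF b(2) bounded_clinear_null_proj [OF b(1)]]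
  note bF = bounded_clinear_range_proj [OF bBN]
  have "?C x = 0" if "A x = 0" for x
    using range_proj_apply [OF bBN, of x] null_proj_ident [OF b(1) that] by simp
  then show qC: "quotient_pair ?C A"
    unfolding quotient_pair_def
    by (intro conjI bounded_clinear_diff bounded_clinear_comp b bF) (auto simp: null_space_def)
  have "op_null (quotient_op A B) = range (B \<circ> null_proj A)"
  proof -
    have "(\<exists>x. B x = y \<and> A x = 0) \<longleftrightarrow> (\<exists>x. y = B (null_proj A x))" for y
      using apply_null_proj [OF b(1)] null_proj_ident [OF b(1)] by metis
    then show ?thesis
      by (auto simp: op_null_def quotient_op_eq_Some_iff [OF q])
  qed
  then have F: "orth_proj (closure (op_null (quotient_op A B))) = ?F"
    by (simp add: range_proj_def)
  show "kaufman_inverse (quotient_op A B) = quotient_op ?C A"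
  proof
    fix y
    show "kaufman_inverse (quotient_op A B) y = quotient_op ?C A y"
    proof (cases "y \<in> range A")
      case True
      then obtain u where u: "y = A u"
        by blast
      have "(THE z. \<exists>x. quotient_op A B x = Some y \<and> z = x - ?F x) = ?C u"
      proof (rule the_equality)
        show "\<exists>x. quotient_op A B x = Some y \<and> ?C u = x - ?F x"
          using u by (intro exI [of _ "B u"]) (simp add: quotient_op_apply [OF q])
        show "z = ?C u" if z: "\<exists>x. quotient_op A B x = Some y \<and> z = x - ?F x" for z
        proof -
          obtain v where "A v = A u" "z = ?C v"
            using z u by (auto simp: quotient_op_eq_Some_iff [OF q])
          then show ?thesis
            using quotient_pair_eq [OF qC] by blast
        qed
      qed
      then have "kaufman_inverse (quotient_op A B) y = Some (?C u)"
        using True by (simp only: kaufman_inverse_def F ran_quotient_op [OF q] if_True)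
      then show ?thesis
        using quotient_op_apply [OF qC, of u] u by simp
    next
      case False
      then have "kaufman_inverse (quotient_op A B) y = None"
        by (simp add: kaufman_inverse_def ran_quotient_op [OF q])
      then show ?thesis
        using False by (simp add: quotient_op_def)
    qed
  qed
qed

text \<open>\<open>A/B\<close> kills exactly the image of \<open>null_space A\<close> under
  \<open>B\<close>. Non-singularity thus says that the reversed pair is also a quotient pair, a
  property that \<Phi> preserves.\<close>

lemma nonsingular_quotient_iff:
  assumes q: "quotient_pair A B"
  shows "nonsingular (quotient_op A B) \<longleftrightarrow> null_space A \<subseteq> null_space B"
proof
  have b: "bounded_clinear A" "bounded_clinear B"
    using q by (simp_all add: quotient_pair_def)
  show "null_space A \<subseteq> null_space B" if "nonsingular (quotient_op A B)"
  proof
    fix x assume "x \<in> null_space A"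
    then have "quotient_op A B (B x) = quotient_op A B (B 0)"
      by (simp only: quotient_op_apply [OF q]) (simp add: null_space_def bounded_clinear_simps [OF b(1)])
    then have "B x = B 0"
      using that unfolding nonsingular_def dom_quotient_op by (meson inj_onD rangeI)
    then show "x \<in> null_space B"
      by (simp add: null_space_def bounded_clinear_simps [OF b(2)])
  qed
  show "nonsingular (quotient_op A B)" if "null_space A \<subseteq> null_space B"
  proof -
    have "quotient_pair B A"
      using that b by (simp add: quotient_pair_def)
    then show ?thesis
      using quotient_pair_eq quotient_op_apply [OF q]
      by (auto simp: nonsingular_def dom_quotient_op inj_on_def)
  qed
qed

lemma op_inverse_quotient:
  assumes q: "quotient_pair A B" and q': "quotient_pair B A"
  shows "op_inverse (quotient_op A B) = quotient_op B A"
proof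
  fix y
  show "op_inverse (quotient_op A B) y = quotient_op B A y"
  proof (cases "y \<in> range A")
    case True
    then obtain u where u: "y = A u"
      by blast
    have "(THE x. quotient_op A B x = Some y) = B u"
    proof (rule the_equality)
      show "quotient_op A B (B u) = Some y"
        by (simp add: u quotient_op_apply [OF q])
      show "x = B u" if x: "quotient_op A B x = Some y" for x
      proof -
        obtain v where "B v = x" "A v = A u"
          using x u by (auto simp: quotient_op_eq_Some_iff [OF q])
        then show ?thesis
          using quotient_pair_eq [OF q', of v u] by simp
      qed
    qed
    then show ?thesis
      using True quotient_op_apply [OF q', of u] u
      by (simp add: op_inverse_def ran_quotient_op [OF q])
  next
    case False
    then have "op_inverse (quotient_op A B) y = None"
      by (simp add: op_inverse_def ran_quotient_op [OF q])
    then show ?thesis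
      using False by (simp add: quotient_op_def)
  qed
qed

text \<open>Continuity at 0 with tolerance 1 becomes, by homogeneity, the bound required by
  \<open>in_range_cadjointI\<close>; the constant \<open>2 / d\<close> comes from rescaling
  \<open>B u\<close> to length \<open>d / 2\<close>.\<close>

lemma continuous_quotient_iff:
  assumes q: "quotient_pair A B"
  shows "continuous_on (range B) (\<lambda>x. cinner (the (quotient_op A B x)) y)
    \<longleftrightarrow> cadjoint A y \<in> range (cadjoint B)"
proof
  have b: "bounded_clinear A" "bounded_clinear B"
    using q by (simp_all add: quotient_pair_def)
  let ?f = "\<lambda>x. cinner (the (quotient_op A B x)) y"
  have f: "?f (B u) = cinner (A u) y" for u
    by (simp add: quotient_op_apply [OF q])
  show "continuous_on (range B) ?f" if in_range: "cadjoint A y \<in> range (cadjoint B)"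
  proof -
    obtain z where z: "cadjoint A y = cadjoint B z"
      using in_range by blast
    have "?f (B u) = cinner (B u) z" for u
      unfolding f using z by (simp flip: cinner_cadjoint_right [OF b(1)] cinner_cadjoint_right [OF b(2)])
    then have "continuous_on (range B) ?f \<longleftrightarrow> continuous_on (range B) (\<lambda>x. cinner x z)"
      by (intro continuous_on_cong) auto
    then show ?thesis
      using continuous_on_cinner_left by blast
  qed
  show "cadjoint A y \<in> range (cadjoint B)" if cont: "continuous_on (range B) ?f"
  proof -
    have B0: "B 0 = 0" and A0: "A 0 = 0"
      using bounded_clinear_simps b by blast+
    have "0 \<in> range B"
      using B0 by (metis rangeI)
    then obtain d where d: "d > 0" "\<And>x. x \<in> range B \<Longrightarrow> dist x 0 < d \<Longrightarrow> dist (?f x) (?f 0) < 1"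
      using cont unfolding continuous_on_iff by (metis zero_less_one)
    have small: "cmod (cinner (A u) y) < 1" if "norm (B u) < d" for u
      using d(2) [of "B u"] that f [of u] f [of 0] by (simp add: B0 A0 dist_norm)
    have "\<bar>inner u (cadjoint A y)\<bar> \<le> (2 / d) * norm (B u)" for u
    proof -
      have le: "\<bar>inner (A v) y\<bar> \<le> cmod (cinner (A v) y)" for v
        by (simp add: inner_eq_Re_cinner abs_Re_le_cmod)
      have scaled: "\<bar>t\<bar> * \<bar>inner (A u) y\<bar> < 1" if "\<bar>t\<bar> * norm (B u) < d" for t :: real
        using order_le_less_trans [OF le small, of "t *\<^sub>R u"] that
        by (simp add: bounded_clinear_simps [OF b(1)] bounded_clinear_simps [OF b(2)] abs_mult)
      have "\<bar>inner (A u) y\<bar> \<le> (2 / d) * norm (B u)"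
      proof (cases "norm (B u) = 0")
        case True
        \<comment> \<open>When \<open>B u = 0\<close> every multiple of \<open>u\<close> is
          admissible; the multiple by \<open>1 / inner (A u) y\<close> would give
          \<open>1 < 1\<close>.\<close>
        have "\<bar>inner (A u) y\<bar> = 0"
        proof (rule ccontr)
          assume "\<bar>inner (A u) y\<bar> \<noteq> 0"
          then show False
            using scaled [of "1 / inner (A u) y"] True d(1) by simp
        qed
        then show ?thesis
          using True by simp
      next
        case False
        then show ?thesis
          using scaled [of "d / (2 * norm (B u))"] d(1) by (simp add: field_simps)
      qed
      then show ?thesis
        by (simp add: inner_cadjoint_right b)
    qed
    then show ?thesis
      by (rule in_range_cadjointI [OF b(2)])
  qed
qed

text \<open>The adjoint at \<open>y\<close> is the solution \<open>z\<close> of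
  \<open>cadjoint B z = cadjoint A y\<close> in the closure of \<open>range B\<close>. For
  \<open>y = E v\<close> one solution is \<open>U v\<close>; \<open>range_proj B\<close> moves it
  into that closure without changing its image under \<open>cadjoint B\<close>.\<close>

lemma op_adjoint_quotient:
  assumes q: "quotient_pair A B" and E: "bounded_clinear E" and U: "bounded_clinear U"
    and pb: "pullback (cadjoint A) (cadjoint B) E U"
  shows "quotient_pair (range_proj B \<circ> U) E" (is "quotient_pair ?C E")
    and "op_adjoint (quotient_op A B) = quotient_op (range_proj B \<circ> U) E"
proof -
  have b: "bounded_clinear A" "bounded_clinear B"
    using q by (simp_all add: quotient_pair_def)
  note bP = bounded_clinear_range_proj [OF b(2)] and B' = bounded_clinear_cadjoint [OF b(2)]
    and A' = bounded_clinear_cadjoint [OF b(1)]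
  have BU: "cadjoint B (U x) = cadjoint A (E x)" for x
    using pb by (simp add: pullback_def)
  have "?C x = 0" if "E x = 0" for x
    using that BU [of x] null_proj_ident [OF B', of "U x"]
    by (simp add: range_proj_eq [OF b(2)] bounded_clinear_simps [OF A'])
  then show qC: "quotient_pair ?C E"
    unfolding quotient_pair_def
    by (intro conjI bounded_clinear_comp bP U E) (auto simp: null_space_def)
  have range_iff: "cadjoint A y \<in> range (cadjoint B) \<longleftrightarrow> y \<in> range E" for y
    using pb BU by (auto simp: pullback_def) (metis rangeI)
  show "op_adjoint (quotient_op A B) = quotient_op ?C E"
  proof
    fix y
    show "op_adjoint (quotient_op A B) y = quotient_op ?C E y"
    proof (cases "y \<in> range E")
      case True
      then obtain v where v: "y = E v"
        by blast
      let ?P = "\<lambda>z. z \<in> closure (range B) \<and>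
        (\<forall>x\<in>range B. cinner (the (quotient_op A B x)) y = cinner x z)"
      have P_iff: "?P z \<longleftrightarrow> z \<in> closure (range B) \<and> cadjoint A y = cadjoint B z" for z
      proof -
        have "(\<forall>u. cinner (A u) y = cinner (B u) z) \<longleftrightarrow> cadjoint A y = cadjoint B z"
        proof
          assume *: "\<forall>u. cinner (A u) y = cinner (B u) z"
          show "cadjoint A y = cadjoint B z"
          proof (rule inner_eqI)
            show "inner u (cadjoint A y) = inner u (cadjoint B z)" for u
              using arg_cong [OF * [rule_format, of u], of Re]
              by (simp add: inner_cadjoint_right b flip: inner_eq_Re_cinner)
          qed
        qed (simp flip: cinner_cadjoint_right [OF b(1)] cinner_cadjoint_right [OF b(2)])
        then show ?thesis
          by (simp add: quotient_op_apply [OF q])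
      qed
      have "(THE z. ?P z) = ?C v"
      proof (rule the_equality)
        show "?P (?C v)"
          unfolding P_iff
          by (simp add: range_proj_in b cadjoint_range_proj_apply BU v)
        show "z = ?C v" if "?P z" for z
        proof -
          have z: "z \<in> closure (range B)" "cadjoint A y = cadjoint B z"
            using that unfolding P_iff by blast+
          then have "cadjoint B (z - U v) = 0"
            using BU [of v] v by (simp add: bounded_clinear_simps [OF B'])
          then have "range_proj B (z - U v) = 0"
            by (simp add: range_proj_eq [OF b(2)] null_proj_ident [OF B'])
          then show ?thesis
            using range_proj_ident [OF b(2) z(1)] by (simp add: bounded_clinear_simps [OF bP])
        qed
      qed
      then have "op_adjoint (quotient_op A B) y = Some (?C v)"
        using True continuous_quotient_iff [OF q, of y]
        by (simp only: op_adjoint_def dom_quotient_op range_iff if_True)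
      then show ?thesis
        using quotient_op_apply [OF qC, of v] v by simp
    next
      case False
      then have "op_adjoint (quotient_op A B) y = None"
        using continuous_quotient_iff [OF q, of y]
        by (simp add: op_adjoint_def dom_quotient_op range_iff)
      then show ?thesis
        using False by (simp add: quotient_op_def)
    qed
  qed
qed

section \<open>The extension to affiliated quotients\<close>

context normal_star_hom
begin

lemma quotient_pairI: "A \<in> M \<Longrightarrow> B \<in> M \<Longrightarrow> null_space B \<subseteq> null_space A \<Longrightarrow> quotient_pair A B"
  by (simp add: quotient_pair_def M.bounded)

lemma hom_quotient_pair:
  assumes "A \<in> M" "B \<in> M" "quotient_pair A B"
  shows "quotient_pair (\<Phi> A) (\<Phi> B)"
  using assms hom_null_space_mono by (simp add: quotient_pair_def hom_bounded)

text \<open>Equal domains give \<open>B' = B C\<close> with \<open>C\<close> in \<open>M\<close>,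
  and equal values give \<open>A' = A C\<close>. Both identities survive \<Phi> and show one
  inclusion of graphs; exchanging the representations gives the other.\<close>

lemma hom_quotient_op_le:
  assumes mem: "A \<in> M" "B \<in> M" "A' \<in> M" "B' \<in> M"
    and q: "quotient_pair A B" and q': "quotient_pair A' B'"
    and eq: "quotient_op A' B' = quotient_op A B"
    and Some: "quotient_op (\<Phi> A') (\<Phi> B') y = Some z"
  shows "quotient_op (\<Phi> A) (\<Phi> B) y = Some z"
proof -
  have "range B' \<subseteq> range B"
    using dom_quotient_op [of A B] dom_quotient_op [of A' B'] eq by simp
  then obtain C where C: "C \<in> M" "\<And>x. B (C x) = B' x"
    using M.range_subset_factor [OF mem(4) mem(2)] by metis
  have AC: "A (C x) = A' x" for x
    using quotient_op_apply [OF q', of x] quotient_op_apply [OF q, of "C x"] eq C(2) by simp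
  obtain x where x: "\<Phi> B' x = y" "\<Phi> A' x = z"
    using Some quotient_op_eq_Some_iff [OF hom_quotient_pair [OF mem(3,4) q']] by blast
  have "\<Phi> B (\<Phi> C x) = y" "\<Phi> A (\<Phi> C x) = z"
    using hom_comp_eq [OF mem(2) C(1) mem(4) C(2)] hom_comp_eq [OF mem(1) C(1) mem(3) AC] x by auto
  then show ?thesis
    using quotient_op_eq_Some_iff [OF hom_quotient_pair [OF mem(1,2) q]] by blast
qed

lemma affiliated_ext_quotient:
  assumes mem: "A \<in> M" "B \<in> M" and q: "quotient_pair A B"
  shows "affiliated_ext M \<Phi> (quotient_op A B) = quotient_op (\<Phi> A) (\<Phi> B)"
  unfolding affiliated_ext_def
proof (rule the_equality)
  show "\<exists>A'\<in>M. \<exists>B'\<in>M. null_space B' \<subseteq> null_space A' \<and>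
      quotient_op A B = quotient_op A' B' \<and> quotient_op (\<Phi> A) (\<Phi> B) = quotient_op (\<Phi> A') (\<Phi> B')"
    using mem q by (auto simp: quotient_pair_def)
next
  fix S
  assume "\<exists>A'\<in>M. \<exists>B'\<in>M. null_space B' \<subseteq> null_space A' \<and>
      quotient_op A B = quotient_op A' B' \<and> S = quotient_op (\<Phi> A') (\<Phi> B')"
  then obtain A' B' where mem': "A' \<in> M" "B' \<in> M" and q': "quotient_pair A' B'"
    and eq: "quotient_op A B = quotient_op A' B'" and S: "S = quotient_op (\<Phi> A') (\<Phi> B')"
    using quotient_pairI by blast
  show "S = quotient_op (\<Phi> A) (\<Phi> B)"
    unfolding S
    using hom_quotient_op_le [OF mem mem' q q' eq [symmetric]]
      hom_quotient_op_le [OF mem' mem q' q eq]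
    by (intro map_eqI) blast
qed

lemma affiliatedE:
  assumes "T \<in> affiliated M"
  obtains A B where "A \<in> M" "B \<in> M" "quotient_pair A B" "T = quotient_op A B"
    "quotient_pair (\<Phi> A) (\<Phi> B)" "affiliated_ext M \<Phi> T = quotient_op (\<Phi> A) (\<Phi> B)"
proof -
  obtain A B where "A \<in> M" "B \<in> M" "null_space B \<subseteq> null_space A" "T = quotient_op A B"
    using assms by (auto simp: affiliated_def)
  then show ?thesis
    using that quotient_pairI hom_quotient_pair affiliated_ext_quotient by blast
qed

section \<open>Compatibility of the extension with sums, products, inverses and adjoints\<close>

lemma affiliated_ext_add:
  assumes "T\<^sub>1 \<in> affiliated M" "T\<^sub>2 \<in> affiliated M"
  shows "affiliated_ext M \<Phi> (op_add T\<^sub>1 T\<^sub>2) = op_add (affiliated_ext M \<Phi> T\<^sub>1) (affiliated_ext M \<Phi> T\<^sub>2)"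
proof -
  from assms(1) obtain A\<^sub>1 B\<^sub>1 where 1: "A\<^sub>1 \<in> M" "B\<^sub>1 \<in> M" "quotient_pair A\<^sub>1 B\<^sub>1" "T\<^sub>1 = quotient_op A\<^sub>1 B\<^sub>1"
    "quotient_pair (\<Phi> A\<^sub>1) (\<Phi> B\<^sub>1)" "affiliated_ext M \<Phi> T\<^sub>1 = quotient_op (\<Phi> A\<^sub>1) (\<Phi> B\<^sub>1)"
    by (rule affiliatedE)
  from assms(2) obtain A\<^sub>2 B\<^sub>2 where 2: "A\<^sub>2 \<in> M" "B\<^sub>2 \<in> M" "quotient_pair A\<^sub>2 B\<^sub>2" "T\<^sub>2 = quotient_op A\<^sub>2 B\<^sub>2"
    "quotient_pair (\<Phi> A\<^sub>2) (\<Phi> B\<^sub>2)" "affiliated_ext M \<Phi> T\<^sub>2 = quotient_op (\<Phi> A\<^sub>2) (\<Phi> B\<^sub>2)"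
    by (rule affiliatedE)
  obtain E U where EU: "E \<in> M" "U \<in> M" and pb: "pullback B\<^sub>2 B\<^sub>1 E U" "pullback (\<Phi> B\<^sub>2) (\<Phi> B\<^sub>1) (\<Phi> E) (\<Phi> U)"
    using pullback_exists [OF 2(2) 1(2)] by blast
  note mem = 1(1,2) 2(1,2) EU
  note add = op_add_quotient [OF 1(3) 2(3) M.bounded [OF EU(1)] M.bounded [OF EU(2)] pb(1)]
    and \<Phi>_add = op_add_quotient [OF 1(5) 2(5) hom_bounded [OF EU(1)] hom_bounded [OF EU(2)] pb(2)]
  have "affiliated_ext M \<Phi> (op_add T\<^sub>1 T\<^sub>2)
      = quotient_op (\<Phi> (\<lambda>x. (A\<^sub>1 \<circ> U) x + (A\<^sub>2 \<circ> E) x)) (\<Phi> (B\<^sub>2 \<circ> E))"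
    unfolding 1(4) 2(4) add(2)
    by (intro affiliated_ext_quotient add(1) M.add_mem M.comp_mem mem)
  then show ?thesis
    unfolding 1(6) 2(6) \<Phi>_add(2) by (simp only: hom_add hom_comp M.comp_mem mem)
qed

lemma affiliated_ext_map_comp:
  assumes "T\<^sub>1 \<in> affiliated M" "T\<^sub>2 \<in> affiliated M"
  shows "affiliated_ext M \<Phi> (T\<^sub>1 \<circ>\<^sub>m T\<^sub>2) = affiliated_ext M \<Phi> T\<^sub>1 \<circ>\<^sub>m affiliated_ext M \<Phi> T\<^sub>2"
proof -
  from assms(1) obtain A\<^sub>1 B\<^sub>1 where 1: "A\<^sub>1 \<in> M" "B\<^sub>1 \<in> M" "quotient_pair A\<^sub>1 B\<^sub>1" "T\<^sub>1 = quotient_op A\<^sub>1 B\<^sub>1"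
    "quotient_pair (\<Phi> A\<^sub>1) (\<Phi> B\<^sub>1)" "affiliated_ext M \<Phi> T\<^sub>1 = quotient_op (\<Phi> A\<^sub>1) (\<Phi> B\<^sub>1)"
    by (rule affiliatedE)
  from assms(2) obtain A\<^sub>2 B\<^sub>2 where 2: "A\<^sub>2 \<in> M" "B\<^sub>2 \<in> M" "quotient_pair A\<^sub>2 B\<^sub>2" "T\<^sub>2 = quotient_op A\<^sub>2 B\<^sub>2"
    "quotient_pair (\<Phi> A\<^sub>2) (\<Phi> B\<^sub>2)" "affiliated_ext M \<Phi> T\<^sub>2 = quotient_op (\<Phi> A\<^sub>2) (\<Phi> B\<^sub>2)"
    by (rule affiliatedE)
  obtain E U where EU: "E \<in> M" "U \<in> M" and pb: "pullback A\<^sub>2 B\<^sub>1 E U" "pullback (\<Phi> A\<^sub>2) (\<Phi> B\<^sub>1) (\<Phi> E) (\<Phi> U)"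
    using pullback_exists [OF 2(1) 1(2)] by blast
  note mem = 1(1,2) 2(1,2) EU
  note comp = map_comp_quotient [OF 1(3) 2(3) M.bounded [OF EU(1)] M.bounded [OF EU(2)] pb(1)]
    and \<Phi>_comp = map_comp_quotient [OF 1(5) 2(5) hom_bounded [OF EU(1)] hom_bounded [OF EU(2)] pb(2)]
  have "affiliated_ext M \<Phi> (T\<^sub>1 \<circ>\<^sub>m T\<^sub>2) = quotient_op (\<Phi> (A\<^sub>1 \<circ> U)) (\<Phi> (B\<^sub>2 \<circ> E))"
    unfolding 1(4) 2(4) comp(2) by (intro affiliated_ext_quotient comp(1) M.comp_mem mem)
  then show ?thesis
    unfolding 1(6) 2(6) \<Phi>_comp(2) by (simp only: hom_comp mem)
qed

lemma affiliated_ext_kaufman_inverse: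
  assumes "T \<in> affiliated M"
  shows "affiliated_ext M \<Phi> (kaufman_inverse T) = kaufman_inverse (affiliated_ext M \<Phi> T)"
proof -
  from assms obtain A B where AB: "A \<in> M" "B \<in> M" "quotient_pair A B" "T = quotient_op A B"
    "quotient_pair (\<Phi> A) (\<Phi> B)" "affiliated_ext M \<Phi> T = quotient_op (\<Phi> A) (\<Phi> B)"
    by (rule affiliatedE)
  note mem = AB(1,2) M.comp_mem M.null_proj_mem M.range_proj_mem
  note inv = kaufman_inverse_quotient [OF AB(3)] and \<Phi>_inv = kaufman_inverse_quotient [OF AB(5)]
  have "affiliated_ext M \<Phi> (kaufman_inverse T)
      = quotient_op (\<Phi> (\<lambda>x. B x - (range_proj (B \<circ> null_proj A) \<circ> B) x)) (\<Phi> A)"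
    unfolding AB(4) inv(2) by (intro affiliated_ext_quotient inv(1) M.diff_mem mem)
  then show ?thesis
    unfolding AB(6) \<Phi>_inv(2) by (simp only: hom_diff hom_comp hom_null_proj hom_range_proj mem)
qed

lemma affiliated_ext_inverse:
  assumes "T \<in> affiliated M" and "nonsingular T"
  shows "nonsingular (affiliated_ext M \<Phi> T)"
    and "affiliated_ext M \<Phi> (op_inverse T) = op_inverse (affiliated_ext M \<Phi> T)"
proof -
  from assms(1) obtain A B where AB: "A \<in> M" "B \<in> M" "quotient_pair A B" "T = quotient_op A B"
    "quotient_pair (\<Phi> A) (\<Phi> B)" "affiliated_ext M \<Phi> T = quotient_op (\<Phi> A) (\<Phi> B)"
    by (rule affiliatedE)
  have q: "quotient_pair B A"
    using assms(2) quotient_pairI [OF AB(2,1)] unfolding AB(4) nonsingular_quotient_iff [OF AB(3)]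
    by blast
  note \<Phi>_q = hom_quotient_pair [OF AB(2,1) q]
  show "nonsingular (affiliated_ext M \<Phi> T)"
    unfolding AB(6) nonsingular_quotient_iff [OF AB(5)] using \<Phi>_q by (simp add: quotient_pair_def)
  show "affiliated_ext M \<Phi> (op_inverse T) = op_inverse (affiliated_ext M \<Phi> T)"
    unfolding AB(6) op_inverse_quotient [OF AB(5) \<Phi>_q]
    unfolding AB(4) op_inverse_quotient [OF AB(3) q]
    by (rule affiliated_ext_quotient [OF AB(2,1) q])
qed

lemma affiliated_ext_adjoint:
  assumes "T \<in> affiliated M"
  shows "affiliated_ext M \<Phi> (op_adjoint T) = op_adjoint (affiliated_ext M \<Phi> T)"
proof -
  from assms obtain A B where AB: "A \<in> M" "B \<in> M" "quotient_pair A B" "T = quotient_op A B"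
    "quotient_pair (\<Phi> A) (\<Phi> B)" "affiliated_ext M \<Phi> T = quotient_op (\<Phi> A) (\<Phi> B)"
    by (rule affiliatedE)
  obtain E U where EU: "E \<in> M" "U \<in> M" and pb: "pullback (cadjoint A) (cadjoint B) E U"
    and "pullback (\<Phi> (cadjoint A)) (\<Phi> (cadjoint B)) (\<Phi> E) (\<Phi> U)"
    using pullback_exists [OF M.cadjoint_mem [OF AB(1)] M.cadjoint_mem [OF AB(2)]] by blast
  then have \<Phi>_pb: "pullback (cadjoint (\<Phi> A)) (cadjoint (\<Phi> B)) (\<Phi> E) (\<Phi> U)"
    by (simp only: hom_cadjoint AB)
  note adj = op_adjoint_quotient [OF AB(3) M.bounded [OF EU(1)] M.bounded [OF EU(2)] pb]
    and \<Phi>_adj = op_adjoint_quotient [OF AB(5) hom_bounded [OF EU(1)] hom_bounded [OF EU(2)] \<Phi>_pb]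
  have "affiliated_ext M \<Phi> (op_adjoint T) = quotient_op (\<Phi> (range_proj B \<circ> U)) (\<Phi> E)"
    unfolding AB(4) adj(2)
    by (intro affiliated_ext_quotient adj(1) M.comp_mem M.range_proj_mem AB EU)
  then show ?thesis
    unfolding AB(6) \<Phi>_adj(2) by (simp only: hom_comp hom_range_proj M.range_proj_mem AB EU)
qed

end

theorem theorem4p14:
  fixes M :: "('h::complex_hilbert_space \<Rightarrow> 'h) set"
    and N :: "('k::complex_hilbert_space \<Rightarrow> 'k) set"
    and \<Phi> :: "('h \<Rightarrow> 'h) \<Rightarrow> ('k \<Rightarrow> 'k)"
  assumes "von_neumann_algebra M"
    and "von_neumann_algebra N"
    and "unital_star_homomorphism M N \<Phi>"
    and "normal_map M N \<Phi>"
  shows "(\<forall>T\<^sub>1\<in>affiliated M. \<forall>T\<^sub>2\<in>affiliated M.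
            affiliated_ext M \<Phi> (op_add T\<^sub>1 T\<^sub>2) =
              op_add (affiliated_ext M \<Phi> T\<^sub>1) (affiliated_ext M \<Phi> T\<^sub>2))
       \<and> (\<forall>T\<^sub>1\<in>affiliated M. \<forall>T\<^sub>2\<in>affiliated M.
            affiliated_ext M \<Phi> (T\<^sub>1 \<circ>\<^sub>m T\<^sub>2) =
              affiliated_ext M \<Phi> T\<^sub>1 \<circ>\<^sub>m affiliated_ext M \<Phi> T\<^sub>2)
       \<and> (\<forall>T\<^sub>1\<in>affiliated M.
            affiliated_ext M \<Phi> (kaufman_inverse T\<^sub>1) =
              kaufman_inverse (affiliated_ext M \<Phi> T\<^sub>1))
       \<and> (\<forall>T\<in>affiliated M. nonsingular T \<longrightarrow>
            nonsingular (affiliated_ext M \<Phi> T) \<and>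
            affiliated_ext M \<Phi> (op_inverse T) = op_inverse (affiliated_ext M \<Phi> T))
       \<and> (\<forall>T\<^sub>1\<in>affiliated M.
            affiliated_ext M \<Phi> (op_adjoint T\<^sub>1) =
              op_adjoint (affiliated_ext M \<Phi> T\<^sub>1))"
proof -
  interpret normal_star_hom M N \<Phi>
    using assms by (simp add: normal_star_hom_def normal_star_hom_axioms_def vN_algebra_def)
  show ?thesis
    using affiliated_ext_add affiliated_ext_map_comp affiliated_ext_kaufman_inverse
      affiliated_ext_inverse affiliated_ext_adjoint
    by blast
qed

end
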